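(* Let $T>0$, let $\mu$ be a stochastic measure on the Borel $\sigma$-algebra of $[0,T]$ such that the process $\mu_t=\mu((0,t])$, $0\le t\le T$, has continuous paths, and let $V_t$, $0\le t\le T$, be a continuous process of bounded variation on $[0,T]$ (defined on the same probability space). Let $f\in C^{1,1}(\mathbb{R}^2)$ and put $F(x,v)=\int_0^x f(y,v)\,dy$. Then the symmetric integral $\int_{(0,T]} f(\mu_t,V_t)\circ d\mu_t$ is well defined, and $$\int_{(0,T]} f(\mu_t,V_t)\circ d\mu_t = F(\mu_T,V_T)-F(\mu_0,V_0)-\int_{(0,T]} F_2'(\mu_t,V_t)\,dV_t \quad\text{a.s.}$$
   Context: Let $(\Omega,\mathcal{F},\mathsf{P})$ be a complete probability space and $L_0=L_0(\Omega,\mathcal{F},\mathsf{P})$ the space of (classes of) real-valued random variables with convergence in probability. A stochastic measure on a measurable space $(X,\mathcal{B})$ is a $\sigma$-additive mapping $\mu:\mathcal{B}\to L_0$, i.e. for pairwise disjoint $A_n\in\mathcal{B}$ one has $\mu(\bigcup_n A_n)=\sum_n\mu(A_n)$ with convergence in probability; no positivity, moment, martingale or adaptedness assumption is made. Symmetric (Stratonovich-type) integral: for random processes $\xi_t,\eta_t$ on $[0,T]$, $$\int_{(0,T]}\xi_t\circ d\eta_t:=\operatorname*{p\,lim}_{n\to\infty}\sum_{k=1}^{j_n}\frac{\xi_{t_{k-1}^n}+\xi_{t_k^n}}{2}\,\bigl(\eta_{t_k^n}-\eta_{t_{k-1}^n}\bigr),$$ where $0=t_0^n<t_1^n<\dots<t_{j_n}^n=T$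 is a sequence of partitions with $\max_k|t_k^n-t_{k-1}^n|\to0$ as $n\to\infty$, provided this limit in probability exists. The integral is well defined if the limit exists for every such sequence of partitions and does not depend on the sequence. $C^{k,l}(\mathbb{R}^2)$ denotes functions that have continuous partial derivatives up to order $k$ in the first variable and up to order $l$ in the second variable. $F_2'$ is the partial derivative of $F$ in its second variable. A continuous process of bounded variation is a process whose paths are continuous and of bounded variation on $[0,T]$; the integral with respect to $dV_t$ is the pathwise Stieltjes integral. *)

theory Defs
  imports "HOL-Probability.Probability"
begin

text \<open>Elements of \<open>L\<^sub>0\<close> are represented by real random variables, equality in \<open>L\<^sub>0\<close> being almost sure
  equality.  Measurability is part of convergence in probability because \<^const>\<open>measure\<close> is \<open>0\<close> on
  non-measurable sets.\<close>

definition conv_in_prob :: "'a measure \<Rightarrow> (nat \<Rightarrow> 'a \<Rightarrow> real) \<Rightarrow> ('a \<Rightarrow> real) \<Rightarrow> bool" where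
  "conv_in_prob M X Y \<longleftrightarrow>
     (\<forall>n. X n \<in> borel_measurable M) \<and> Y \<in> borel_measurable M \<and>
     (\<forall>\<epsilon>>0. (\<lambda>n. measure M {\<omega> \<in> space M. \<bar>X n \<omega> - Y \<omega>\<bar> > \<epsilon>}) \<longlonglongrightarrow> 0)"

text \<open>\<open>M\<close> is the underlying probability space, \<open>N\<close> carries the measurable space on which the
  stochastic measure is defined; the measure component of \<open>N\<close> is irrelevant.\<close>

definition stochastic_measure :: "'a measure \<Rightarrow> 'x measure \<Rightarrow> ('x set \<Rightarrow> 'a \<Rightarrow> real) \<Rightarrow> bool" where
  "stochastic_measure M N \<mu> \<longleftrightarrow>
     (\<forall>A \<in> sets N. \<mu> A \<in> borel_measurable M) \<and>
     (\<forall>A. range A \<subseteq> sets N \<longrightarrow> disjoint_family A \<longrightarrow>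
        conv_in_prob M (\<lambda>n \<omega>. \<Sum>k<n. \<mu> (A k) \<omega>) (\<mu> (\<Union>k. A k)))"

definition partition_points :: "real \<Rightarrow> real \<Rightarrow> nat \<Rightarrow> (nat \<Rightarrow> real) \<Rightarrow> bool" where
  "partition_points a b n t \<longleftrightarrow> t 0 = a \<and> t n = b \<and> (\<forall>k<n. t k < t (Suc k))"

definition mesh :: "nat \<Rightarrow> (nat \<Rightarrow> real) \<Rightarrow> real" where
  "mesh n t = Max ((\<lambda>k. t k - t (k - 1)) ` {1..n})"

definition symmetric_sum ::
    "(real \<Rightarrow> 'a \<Rightarrow> real) \<Rightarrow> (real \<Rightarrow> 'a \<Rightarrow> real) \<Rightarrow> nat \<Rightarrow> (nat \<Rightarrow> real) \<Rightarrow> 'a \<Rightarrow> real" where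
  "symmetric_sum \<xi> \<eta> n t \<omega> =
     (\<Sum>k=1..n. (\<xi> (t (k - 1)) \<omega> + \<xi> (t k) \<omega>) / 2 * (\<eta> (t k) \<omega> - \<eta> (t (k - 1)) \<omega>))"

text \<open>The limit \<open>I\<close> exists along every sequence of partitions and does not depend on the sequence;
  \<open>I\<close> is determined up to almost sure equality.\<close>

definition has_symmetric_integral ::
    "'a measure \<Rightarrow> real \<Rightarrow> (real \<Rightarrow> 'a \<Rightarrow> real) \<Rightarrow> (real \<Rightarrow> 'a \<Rightarrow> real) \<Rightarrow> ('a \<Rightarrow> real) \<Rightarrow> bool" where
  "has_symmetric_integral M T \<xi> \<eta> I \<longleftrightarrow>
     (\<forall>j t. (\<forall>n. partition_points 0 T (j n) (t n)) \<longrightarrow> (\<lambda>n. mesh (j n) (t n)) \<longlonglongrightarrow> 0 \<longrightarrow>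
        conv_in_prob M (\<lambda>n. symmetric_sum \<xi> \<eta> (j n) (t n)) I)"

definition bounded_variation :: "real \<Rightarrow> real \<Rightarrow> (real \<Rightarrow> real) \<Rightarrow> bool" where
  "bounded_variation a b v \<longleftrightarrow>
     (\<exists>B. \<forall>n t. partition_points a b n t \<longrightarrow> (\<Sum>k=1..n. \<bar>v (t k) - v (t (k - 1))\<bar>) \<le> B)"

text \<open>Riemann--Stieltjes integral of \<open>g\<close> with respect to \<open>v\<close> over \<open>[a, b]\<close>.  For continuous \<open>v\<close> it
  makes no difference whether the endpoint \<open>a\<close> is included.\<close>

definition has_stieltjes_integral ::
    "(real \<Rightarrow> real) \<Rightarrow> (real \<Rightarrow> real) \<Rightarrow> real \<Rightarrow> real \<Rightarrow> real \<Rightarrow> bool" where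
  "has_stieltjes_integral g v a b J \<longleftrightarrow>
     (\<forall>\<epsilon>>0. \<exists>\<delta>>0. \<forall>n t s.
        partition_points a b n t \<longrightarrow> mesh n t < \<delta> \<longrightarrow> (\<forall>k\<in>{1..n}. s k \<in> {t (k - 1)..t k}) \<longrightarrow>
        \<bar>(\<Sum>k=1..n. g (s k) * (v (t k) - v (t (k - 1)))) - J\<bar> < \<epsilon>)"

definition stieltjes_integrable :: "(real \<Rightarrow> real) \<Rightarrow> (real \<Rightarrow> real) \<Rightarrow> real \<Rightarrow> real \<Rightarrow> bool" where
  "stieltjes_integrable g v a b \<longleftrightarrow> (\<exists>J. has_stieltjes_integral g v a b J)"

definition stieltjes_integral :: "(real \<Rightarrow> real) \<Rightarrow> (real \<Rightarrow> real) \<Rightarrow> real \<Rightarrow> real \<Rightarrow> real" where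
  "stieltjes_integral g v a b = (THE J. has_stieltjes_integral g v a b J)"

text \<open>The class \<open>C\<^sup>k\<^sup>,\<^sup>l(\<real>\<^sup>2)\<close>: pure partial derivatives up to order \<open>k\<close> in the first and up to order \<open>l\<close>
  in the second variable exist and are jointly continuous; no mixed derivatives are required.\<close>

definition C_partial :: "nat \<Rightarrow> nat \<Rightarrow> (real \<Rightarrow> real \<Rightarrow> real) \<Rightarrow> bool" where
  "C_partial k l f \<longleftrightarrow>
     (\<forall>i<k. \<forall>x v. (deriv ^^ i) (\<lambda>y. f y v) field_differentiable at x) \<and>
     (\<forall>i\<le>k. continuous_on UNIV (\<lambda>(x, v). (deriv ^^ i) (\<lambda>y. f y v) x)) \<and>
     (\<forall>i<l. \<forall>x v. (deriv ^^ i) (\<lambda>w. f x w) field_differentiable at v) \<and>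
     (\<forall>i\<le>l. continuous_on UNIV (\<lambda>(x, v). (deriv ^^ i) (\<lambda>w. f x w) v))"

end

theory Submission
  imports Defs
begin

text \<open>Pathwise, on an interval of the partition the trapezoid rule approximates the increment of
  \<open>F(\<cdot>, v)\<close> up to a small multiple of the squared increment of \<open>m\<close>, and the increments in the second
  variable form a Riemann--Stieltjes sum. Hence the symmetric sums differ from the right-hand side by
  at most \<open>\<delta> (1 + Q)\<close> for fine partitions, where \<open>Q\<close> is the sum of the squared increments of \<open>m\<close>, and
  all that is needed is that \<open>Q\<close> stays bounded in probability.

  If it did not, one could choose, from a sufficiently fine partition, a random union \<open>R\<close> of intervals,
  each taken with a small probability \<open>p\<close>. As single increments are small, \<open>|\<mu> R| > 1\<close> with probability
  bounded below (Paley--Zygmund), while \<open>R\<close> rarely carries more than half of a later sum of squares, so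
  that the sums of squares outside \<open>R\<close> are still unbounded. Iterating gives disjoint sets \<open>R\<^sub>n\<close> for which
  \<open>\<mu> R\<^sub>n\<close> does not tend to \<open>0\<close> in probability, against \<open>\<sigma>\<close>-additivity.\<close>

section \<open>Bernoulli subsets of a finite set\<close>

text \<open>The obstacle is that \<mu> has no moments and no independence to exploit. The only
  randomness that is averaged is therefore auxiliary: for fixed \<omega> the choice of cells is
  random, second and fourth moments are taken over this choice, and Fubini for finitely many choices
  produces one deterministic set. \<open>bern_mean\<close> is that average, written as a finite
  weighted sum, so that no product space enters. Three points shape the rest. The set has to be
  fixed before the later partitions on which the sums outside it stay large, whereas the argument
  gives a set for each later partition; all candidates are unions of cells of one finite partition,
  so one of them serves infinitely often. Successive partitions need not refine each other, but the
  cells that straddle are at most as many as the points of the earlier partition, and their squares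
  are small. Each removal lowers the probability level at which the sums are unbounded; the losses
  form a geometric series with sum half of the initial level, so the lower bound on the
  probabilities does not degenerate.\<close>

definition bern_mean :: "real \<Rightarrow> 'i set \<Rightarrow> ('i set \<Rightarrow> real) \<Rightarrow> real" where
  "bern_mean p J g = (\<Sum>S\<in>Pow J. p ^ card S * (1 - p) ^ card (J - S) * g S)"

lemma bern_mean_empty [simp]: "bern_mean p {} g = g {}"
  by (simp add: bern_mean_def)

text \<open>Conditioning on whether \<open>a\<close> is selected. This recursion stands in for
  independence: the moments below are computed by induction along it.\<close>

lemma bern_mean_insert:
  assumes "finite J" "a \<notin> J"
  shows "bern_mean p (insert a J) g
    = p * bern_mean p J (\<lambda>S. g (insert a S)) + (1 - p) * bern_mean p J g"
proof -
  have "bern_mean p (insert a J) g =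
      (\<Sum>S\<in>Pow J. p ^ card S * (1 - p) ^ card (insert a J - S) * g S)
      + (\<Sum>S\<in>insert a ` Pow J. p ^ card S * (1 - p) ^ card (insert a J - S) * g S)"
    unfolding bern_mean_def Pow_insert using assms
    by (intro sum.union_disjoint) auto
  also have "(\<Sum>S\<in>insert a ` Pow J. p ^ card S * (1 - p) ^ card (insert a J - S) * g S)
      = (\<Sum>S\<in>Pow J. p ^ card (insert a S) * (1 - p) ^ card (insert a J - insert a S) * g (insert a S))"
    using assms(2) by (subst sum.reindex) (auto simp: inj_on_def)
  also have "\<dots> = p * bern_mean p J (\<lambda>S. g (insert a S))"
    unfolding bern_mean_def sum_distrib_left
  proof (intro sum.cong refl)
    fix S assume "S \<in> Pow J"
    then have "card (insert a S) = Suc (card S)" "insert a J - insert a S = J - S"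
      using assms by (auto intro!: card_insert_disjoint intro: finite_subset)
    then show "p ^ card (insert a S) * (1 - p) ^ card (insert a J - insert a S) * g (insert a S)
        = p * (p ^ card S * (1 - p) ^ card (J - S) * g (insert a S))" by simp
  qed
  also have "(\<Sum>S\<in>Pow J. p ^ card S * (1 - p) ^ card (insert a J - S) * g S) = (1 - p) * bern_mean p J g"
    unfolding bern_mean_def sum_distrib_left
  proof (intro sum.cong refl)
    fix S assume "S \<in> Pow J"
    then have "insert a J - S = insert a (J - S)" using assms by auto
    then have "card (insert a J - S) = Suc (card (J - S))" using assms by simp
    then show "p ^ card S * (1 - p) ^ card (insert a J - S) * g S
        = (1 - p) * (p ^ card S * (1 - p) ^ card (J - S) * g S)" by simp
  qed
  finally show ?thesis by simp
qed

lemma bern_mean_add: "bern_mean p J (\<lambda>S. g S + h S) = bern_mean p J g + bern_mean p J h"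
  by (simp add: bern_mean_def distrib_left sum.distrib)

lemma bern_mean_diff: "bern_mean p J (\<lambda>S. g S - h S) = bern_mean p J g - bern_mean p J h"
  by (simp add: bern_mean_def right_diff_distrib sum_subtractf)

lemma bern_mean_cmult: "bern_mean p J (\<lambda>S. c * g S) = c * bern_mean p J g"
  by (simp add: bern_mean_def sum_distrib_left mult_ac)

lemma bern_mean_const: "finite J \<Longrightarrow> bern_mean p J (\<lambda>_. c) = c"
  by (induction J rule: finite_induct) (auto simp: bern_mean_insert algebra_simps)

lemma bern_mean_mono:
  assumes "0 \<le> p" "p \<le> 1" "\<And>S. S \<subseteq> J \<Longrightarrow> g S \<le> h S"
  shows "bern_mean p J g \<le> bern_mean p J h"
  unfolding bern_mean_def using assms by (intro sum_mono mult_left_mono) auto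

lemma bern_mean_cong:
  assumes "\<And>S. S \<subseteq> J \<Longrightarrow> g S = h S"
  shows "bern_mean p J g = bern_mean p J h"
  unfolding bern_mean_def using assms by (intro sum.cong) auto

lemma bern_mean_exists_ge:
  assumes "finite J" "0 \<le> p" "p \<le> 1" "c \<le> bern_mean p J g"
  obtains S where "S \<subseteq> J" "c \<le> g S"
proof (rule ccontr)
  assume *: "\<not> thesis"
  have less: "g S < c" if "S \<subseteq> J" for S
    using * that \<open>\<And>S. S \<subseteq> J \<Longrightarrow> c \<le> g S \<Longrightarrow> thesis\<close> not_le by blast
  \<comment> \<open>Monotonicity of the mean is not strict; the maximum over the finite power set
    turns the strict pointwise bound into a single constant below \<open>c\<close>.\<close>
  define d where "d = Max (g ` Pow J)"
  have "d \<in> g ` Pow J" unfolding d_def using assms(1) by (intro Max_in) auto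
  then have "d < c" using less by auto
  have "bern_mean p J g \<le> bern_mean p J (\<lambda>_. d)"
    using assms by (intro bern_mean_mono) (auto simp: d_def)
  also have "\<dots> = d" by (rule bern_mean_const[OF assms(1)])
  finally show False using \<open>d < c\<close> assms by simp
qed

lemma bern_mean_sum:
  assumes "finite J"
  shows "bern_mean p J (\<lambda>S. \<Sum>k\<in>S. x k) = p * (\<Sum>k\<in>J. x k)"
  using assms
proof (induction J rule: finite_induct)
  case (insert a J)
  have "bern_mean p J (\<lambda>S. \<Sum>k\<in>insert a S. x k) = bern_mean p J (\<lambda>S. x a + (\<Sum>k\<in>S. x k))"
    using insert by (intro bern_mean_cong sum.insert) (auto intro: finite_subset)
  then show ?case using insert
    by (simp add: bern_mean_insert bern_mean_add bern_mean_const algebra_simps)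
qed simp

text \<open>Every new index adds an independent centred term, so products with an odd first moment
  vanish. The fourth moment keeps the Rosenthal form, a diagonal term plus three times the squared
  variance, which is what a comparison with the squared second moment needs.\<close>

lemma bern_mean_centred:
  fixes x :: "'i \<Rightarrow> real" and p :: real
  assumes "finite J" and p: "0 \<le> p" "p \<le> 1"
  shows "bern_mean p J (\<lambda>S. (\<Sum>k\<in>S. x k) - p * (\<Sum>k\<in>J. x k)) = 0"
    and "bern_mean p J (\<lambda>S. ((\<Sum>k\<in>S. x k) - p * (\<Sum>k\<in>J. x k))\<^sup>2) = p * (1 - p) * (\<Sum>k\<in>J. (x k)\<^sup>2)"
    and "bern_mean p J (\<lambda>S. ((\<Sum>k\<in>S. x k) - p * (\<Sum>k\<in>J. x k)) ^ 4)
      \<le> p * (1 - p) * (\<Sum>k\<in>J. (x k) ^ 4) + 3 * (p * (1 - p) * (\<Sum>k\<in>J. (x k)\<^sup>2))\<^sup>2"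
proof -
  define v where "v = p * (1 - p)"
  define X where "X J S = (\<Sum>k\<in>S. x k) - p * (\<Sum>k\<in>J. x k)" for J S
  \<comment> \<open>\<open>X\<close> keeps the index set as an argument because the centring grows
    with it: the new index shifts the centred sum by (1 - p) x with probability p and by - p x
    otherwise.\<close>
  have step: "bern_mean p (insert a J) (\<lambda>S. h (X (insert a J) S)) =
     bern_mean p J (\<lambda>S. p * h (X J S + (1 - p) * x a) + (1 - p) * h (X J S - p * x a))"
    if J: "finite J" "a \<notin> J" for J a and h :: "real \<Rightarrow> real"
  proof -
    have "X (insert a J) (insert a S) = X J S + (1 - p) * x a" if "S \<subseteq> J" for S
    proof -
      have "finite S" "a \<notin> S" using that J by (auto intro: finite_subset)
      then show ?thesis using J by (simp add: X_def algebra_simps)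
    qed
    moreover have "X (insert a J) S = X J S - p * x a" for S
      using J by (simp add: X_def algebra_simps)
    ultimately have "bern_mean p J (\<lambda>S. h (X (insert a J) (insert a S)))
        = bern_mean p J (\<lambda>S. h (X J S + (1 - p) * x a))"
      "bern_mean p J (\<lambda>S. h (X (insert a J) S)) = bern_mean p J (\<lambda>S. h (X J S - p * x a))"
      by (auto intro!: bern_mean_cong)
    then show ?thesis using J by (simp add: bern_mean_insert bern_mean_add bern_mean_cmult)
  qed
  have 1: "bern_mean p J (X J) = 0" if "finite J" for J
    using bern_mean_sum[OF that, of p x] bern_mean_const[OF that, of p "p * (\<Sum>k\<in>J. x k)"]
    by (simp add: X_def[abs_def] bern_mean_diff)
  show "bern_mean p J (\<lambda>S. (\<Sum>k\<in>S. x k) - p * (\<Sum>k\<in>J. x k)) = 0"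
    using 1[OF assms(1)] by (simp add: X_def[abs_def])
  have 2: "bern_mean p J (\<lambda>S. (X J S)\<^sup>2) = v * (\<Sum>k\<in>J. (x k)\<^sup>2)" if "finite J" for J
    using that
  proof (induction J rule: finite_induct)
    case empty
    show ?case by (simp add: X_def)
  next
    case (insert a J)
    have "p * (z + (1 - p) * y)\<^sup>2 + (1 - p) * (z - p * y)\<^sup>2 = z\<^sup>2 + v * y\<^sup>2" for z y
      by (simp add: v_def power2_eq_square algebra_simps)
    then show ?case using insert
      by (simp add: step[where h = "\<lambda>z. z\<^sup>2"] bern_mean_add bern_mean_const distrib_left)
  qed
  show "bern_mean p J (\<lambda>S. ((\<Sum>k\<in>S. x k) - p * (\<Sum>k\<in>J. x k))\<^sup>2) = p * (1 - p) * (\<Sum>k\<in>J. (x k)\<^sup>2)"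
    using 2[OF assms(1)] by (simp add: X_def[abs_def] v_def)
  have v: "0 \<le> v" using p by (simp add: v_def)
  have v3: "p * (1 - p) ^ 4 + (1 - p) * p ^ 4 \<le> v"
  proof -
    have "(1 - p) ^ 3 \<le> (1 - p) ^ 1" "p ^ 3 \<le> p ^ 1" using p by (intro power_decreasing; simp)+
    then have "(1 - p) ^ 3 + p ^ 3 \<le> 1" by simp
    then have "v * ((1 - p) ^ 3 + p ^ 3) \<le> v * 1" using v by (intro mult_left_mono)
    then show ?thesis by (simp add: v_def power_numeral_reduce algebra_simps)
  qed
  have "bern_mean p J (\<lambda>S. (X J S) ^ 4)
      \<le> v * (\<Sum>k\<in>J. (x k) ^ 4) + 3 * (v * (\<Sum>k\<in>J. (x k)\<^sup>2))\<^sup>2"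
    using assms(1)
  proof (induction J rule: finite_induct)
    case empty
    show ?case by (simp add: X_def)
  next
    case (insert a J)
    define y where "y = x a"
    \<comment> \<open>\<open>v\<close>, \<open>c\<close>, \<open>d\<close> are the second, third and
      fourth moments of a centred Bernoulli variable. The \<open>c\<close> term is linear in
      \<open>z\<close> and drops out because \<open>X J\<close> has mean zero.\<close>
    define c where "c = p * (1 - p) ^ 3 - (1 - p) * p ^ 3"
    define d where "d = p * (1 - p) ^ 4 + (1 - p) * p ^ 4"
    have "p * (z + (1 - p) * y) ^ 4 + (1 - p) * (z - p * y) ^ 4
        = z ^ 4 + 6 * v * y\<^sup>2 * z\<^sup>2 + 4 * c * y ^ 3 * z + d * y ^ 4" for z
      unfolding v_def c_def d_def by (simp add: power_numeral_reduce algebra_simps)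
    then have "bern_mean p (insert a J) (\<lambda>S. (X (insert a J) S) ^ 4) =
       bern_mean p J (\<lambda>S. (X J S) ^ 4) + 6 * v * y\<^sup>2 * (v * (\<Sum>k\<in>J. (x k)\<^sup>2)) + d * y ^ 4"
      using insert 
      by (simp add: step[where h = "\<lambda>z. z ^ 4"] y_def[symmetric] bern_mean_add bern_mean_const bern_mean_cmult 1 2)
    also have "\<dots> \<le> v * (\<Sum>k\<in>J. (x k) ^ 4) + 3 * (v * (\<Sum>k\<in>J. (x k)\<^sup>2))\<^sup>2
       + 6 * v * y\<^sup>2 * (v * (\<Sum>k\<in>J. (x k)\<^sup>2)) + v * y ^ 4"
    proof -
      have "d * y ^ 4 \<le> v * y ^ 4" using v3 by (intro mult_right_mono) (auto simp: d_def)
      then show ?thesis using insert.IH by linarith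
    qed
    \<comment> \<open>The added nonnegative term completes the square of the variance over
      \<open>insert a J\<close>.\<close>
    also have "\<dots> \<le> v * (\<Sum>k\<in>J. (x k) ^ 4) + 3 * (v * (\<Sum>k\<in>J. (x k)\<^sup>2))\<^sup>2
       + 6 * v * y\<^sup>2 * (v * (\<Sum>k\<in>J. (x k)\<^sup>2)) + v * y ^ 4 + 3 * (v * y\<^sup>2)\<^sup>2" by simp
    also have "\<dots> = v * (\<Sum>k\<in>insert a J. (x k) ^ 4) + 3 * (v * (\<Sum>k\<in>insert a J. (x k)\<^sup>2))\<^sup>2"
      using insert by (simp add: y_def[symmetric] power2_eq_square algebra_simps)
    finally show ?case .
  qed
  then show "bern_mean p J (\<lambda>S. ((\<Sum>k\<in>S. x k) - p * (\<Sum>k\<in>J. x k)) ^ 4)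
      \<le> p * (1 - p) * (\<Sum>k\<in>J. (x k) ^ 4) + 3 * (p * (1 - p) * (\<Sum>k\<in>J. (x k)\<^sup>2))\<^sup>2"
    by (simp add: X_def[abs_def] v_def)
qed

text \<open>A variable with second moment t and fourth moment at most 32 t^2 cannot concentrate near
  zero. The bound on single terms turns fourth powers into squares, and variance at least 2 gives
  both s \<le> s^2 and 1 \<le> t / 2. The resulting constant does not depend on \<open>p\<close>,
  which later has to be tiny.\<close>

lemma bern_mean_paley_zygmund:
  fixes x :: "'i \<Rightarrow> real"
  assumes J: "finite J" and p: "0 \<le> p" "p \<le> 1"
    and small: "\<And>k. k \<in> J \<Longrightarrow> \<bar>x k\<bar> \<le> 1"
    and large: "2 \<le> p * (1 - p) * (\<Sum>k\<in>J. (x k)\<^sup>2)"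
  shows "1 / 128 \<le> bern_mean p J (\<lambda>S. of_bool (1 < \<bar>\<Sum>k\<in>S. x k\<bar>))"
proof -
  define s where "s = p * (1 - p) * (\<Sum>k\<in>J. (x k)\<^sup>2)"
  define a where "a = p * (\<Sum>k\<in>J. x k)"
  define X where "X S = (\<Sum>k\<in>S. x k) - a" for S
  define t where "t = s + a\<^sup>2"
  define P where "P = bern_mean p J (\<lambda>S. of_bool (1 < \<bar>\<Sum>k\<in>S. x k\<bar>))"
  note moments = bern_mean_centred[OF J p, where x = x, folded a_def, folded X_def]
  have s: "2 \<le> s" using large by (simp add: s_def)
  have t: "2 \<le> t" using s by (simp add: t_def add_increasing2)
  have m1: "bern_mean p J X = 0" using moments(1) by (simp add: X_def[abs_def])
  have m2: "bern_mean p J (\<lambda>S. (X S)\<^sup>2) = s" using moments(2) by (simp add: s_def)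
  have "(\<Sum>k\<in>J. (x k) ^ 4) \<le> (\<Sum>k\<in>J. (x k)\<^sup>2)"
  proof (intro sum_mono)
    fix k assume "k \<in> J"
    then have "(x k)\<^sup>2 \<le> 1" using small by (simp add: abs_square_le_1)
    then have "(x k)\<^sup>2 * (x k)\<^sup>2 \<le> (x k)\<^sup>2 * 1" by (intro mult_left_mono) auto
    then show "(x k) ^ 4 \<le> (x k)\<^sup>2" by (simp add: power_numeral_reduce mult_ac)
  qed
  then have "p * (1 - p) * (\<Sum>k\<in>J. (x k) ^ 4) \<le> s" unfolding s_def using p by (intro mult_left_mono) auto
  also have "s \<le> s * s" using s by simp
  finally have m4: "bern_mean p J (\<lambda>S. (X S) ^ 4) \<le> 4 * s\<^sup>2"
    using moments(3) by (simp add: s_def power2_eq_square)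
  have Y2: "bern_mean p J (\<lambda>S. (X S + a)\<^sup>2) = t"
  proof -
    have "(\<lambda>S. (X S + a)\<^sup>2) = (\<lambda>S. (X S)\<^sup>2 + 2 * a * X S + a\<^sup>2)" by (auto simp: power2_eq_square algebra_simps)
    then show ?thesis using J by (simp add: bern_mean_add bern_mean_cmult bern_mean_const m1 m2 t_def)
  qed
  have Y4: "bern_mean p J (\<lambda>S. (X S + a) ^ 4) \<le> 32 * t\<^sup>2"
  proof -
    have *: "(z + a) ^ 4 \<le> 8 * z ^ 4 + 8 * a ^ 4" for z :: real
    proof -
      have "(z + a)\<^sup>2 \<le> 2 * (z\<^sup>2 + a\<^sup>2)"
        using zero_le_power2[of "z - a"] by (simp add: power2_eq_square algebra_simps)
      then have "((z + a)\<^sup>2)\<^sup>2 \<le> (2 * (z\<^sup>2 + a\<^sup>2))\<^sup>2" by (intro power_mono) auto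
      also have "\<dots> \<le> 8 * z ^ 4 + 8 * a ^ 4"
        using zero_le_power2[of "z\<^sup>2 - a\<^sup>2"] by (simp add: power_numeral_reduce algebra_simps)
      finally show ?thesis by simp
    qed
    have "bern_mean p J (\<lambda>S. (X S + a) ^ 4) \<le> bern_mean p J (\<lambda>S. 8 * (X S) ^ 4 + 8 * a ^ 4)"
      using p * by (intro bern_mean_mono) auto
    also have "\<dots> \<le> 8 * (4 * s\<^sup>2) + 8 * a ^ 4"
      using J m4 by (simp add: bern_mean_add bern_mean_cmult bern_mean_const)
    also have "\<dots> \<le> 8 * (4 * s\<^sup>2) + 8 * a ^ 4 + (64 * s * a\<^sup>2 + 24 * a ^ 4)" using s by simp
    also have "\<dots> = 32 * t\<^sup>2"
      by (simp add: t_def power2_eq_square power_numeral_reduce algebra_simps)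
    finally show ?thesis .
  qed
  \<comment> \<open>A linearised Cauchy-Schwarz inequality. The coefficient 1 / (128 t) lets the
    fourth moment contribute at most t / 4, and completing the square at 64 t leaves 32 t on the
    event. After averaging, 1 \<le> 3/4 + 32 P, whence 1/128.\<close>
  have pointwise: "(X S + a)\<^sup>2 \<le> t / 2 + (1 / (128 * t)) * (X S + a) ^ 4 + 32 * t * of_bool (1 < \<bar>\<Sum>k\<in>S. x k\<bar>)" for S
  proof (cases "1 < \<bar>\<Sum>k\<in>S. x k\<bar>")
    case True
    define y where "y = (X S + a)\<^sup>2"
    have "0 \<le> (y - 64 * t)\<^sup>2 / (128 * t)" using t by simp
    also have "\<dots> = y\<^sup>2 / (128 * t) - y + 32 * t"
      using t by (simp add: power2_eq_square field_simps)
    finally show ?thesis using True t by (simp add: y_def)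
  next
    case False
    then have "\<bar>X S + a\<bar> \<le> 1" by (simp add: X_def)
    then have "(X S + a)\<^sup>2 \<le> 1" by (simp add: abs_square_le_1)
    also have "1 \<le> t / 2" using t by simp
    finally show ?thesis using t False by (simp add: add_increasing2)
  qed
  have "bern_mean p J (\<lambda>S. (X S + a)\<^sup>2) \<le> bern_mean p J (\<lambda>S. t / 2 + (1 / (128 * t)) * (X S + a) ^ 4
      + 32 * t * of_bool (1 < \<bar>\<Sum>k\<in>S. x k\<bar>))"
    by (intro bern_mean_mono p pointwise)
  then have "t \<le> t / 2 + (1 / (128 * t)) * bern_mean p J (\<lambda>S. (X S + a) ^ 4) + 32 * t * P"
    using J
    by (simp add: Y2 bern_mean_add bern_mean_cmult bern_mean_const P_def del: times_divide_eq_left)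
  also have "\<dots> \<le> t / 2 + (1 / (128 * t)) * (32 * t\<^sup>2) + 32 * t * P"
    using Y4 t by (intro add_mono mult_left_mono) auto
  also have "\<dots> = t * (3 / 4 + 32 * P)" using t by (simp add: power2_eq_square field_simps)
  finally have "1 \<le> 3 / 4 + 32 * P" using t by simp
  then show ?thesis by (simp add: P_def)
qed

text \<open>Markov's inequality: the expected captured weight is \<open>p\<close> times the total.
  This is why \<open>p\<close> is taken small, since cells chosen now then rarely absorb most of the
  sum of squares of a later partition.\<close>

lemma bern_mean_markov:
  fixes q :: "'i \<Rightarrow> real"
  assumes J: "finite J" and p: "0 \<le> p" "p \<le> 1"
    and q: "\<And>k. k \<in> J \<Longrightarrow> 0 \<le> q k" "(\<Sum>k\<in>J. q k) \<le> W" and W: "0 < W"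
  shows "bern_mean p J (\<lambda>S. of_bool (W / 2 < (\<Sum>k\<in>S. q k))) \<le> 2 * p"
proof -
  have "bern_mean p J (\<lambda>S. of_bool (W / 2 < (\<Sum>k\<in>S. q k)))
      \<le> bern_mean p J (\<lambda>S. (2 / W) * (\<Sum>k\<in>S. q k))"
    using W q(1) by (intro bern_mean_mono p) (auto simp: field_simps intro!: sum_nonneg)
  also have "\<dots> = (2 / W) * (p * (\<Sum>k\<in>J. q k))" by (simp only: bern_mean_cmult bern_mean_sum[OF J])
  also have "\<dots> \<le> (2 / W) * (p * W)" using p q W by (intro mult_left_mono) auto
  finally show ?thesis using W by simp
qed

section \<open>Stochastic measures\<close>

lemma (in prob_space) prob_le_add:
  assumes "AE \<omega> in M. P \<omega> \<longrightarrow> Q \<omega> \<or> R \<omega>"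
    and [measurable]: "Measurable.pred M Q" "Measurable.pred M R"
  shows "prob {\<omega> \<in> space M. P \<omega>} \<le> prob {\<omega> \<in> space M. Q \<omega>} + prob {\<omega> \<in> space M. R \<omega>}"
proof -
  have "prob {\<omega> \<in> space M. P \<omega>} \<le> prob ({\<omega> \<in> space M. Q \<omega>} \<union> {\<omega> \<in> space M. R \<omega>})"
    using assms by (intro finite_measure_mono_AE) auto
  also have "\<dots> \<le> prob {\<omega> \<in> space M. Q \<omega>} + prob {\<omega> \<in> space M. R \<omega>}"
    by (intro measure_Un_le) auto
  finally show ?thesis .
qed

lemma abs_diff_gt_half:
  fixes x y z :: real
  assumes "\<bar>y - z\<bar> > e"
  shows "\<bar>y - x\<bar> > e / 2 \<or> \<bar>z - x\<bar> > e / 2"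
  using assms by linarith

lemma (in prob_space) AE_eq_0_if_prob_eq_0:
  assumes [measurable]: "Y \<in> borel_measurable M"
    and "\<And>\<epsilon>. \<epsilon> > 0 \<Longrightarrow> prob {\<omega> \<in> space M. \<bar>Y \<omega> :: real\<bar> > \<epsilon>} = 0"
  shows "AE \<omega> in M. Y \<omega> = 0"
proof -
  have "AE \<omega> in M. \<bar>Y \<omega>\<bar> \<le> 1 / real (Suc n)" for n
  proof -
    have "prob {\<omega> \<in> space M. \<bar>Y \<omega>\<bar> > 1 / real (Suc n)} = 0" by (intro assms) auto
    then have "AE \<omega> in M. \<not> (\<bar>Y \<omega>\<bar> > 1 / real (Suc n))" by (subst (asm) prob_Collect_eq_0) auto
    then show ?thesis by eventually_elim auto
  qed
  then have "AE \<omega> in M. \<forall>n. \<bar>Y \<omega>\<bar> \<le> 1 / real (Suc n)" by (simp add: AE_all_countable)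
  then show ?thesis
  proof eventually_elim
    case (elim \<omega>)
    have "\<bar>Y \<omega>\<bar> \<le> 0"
      using LIMSEQ_inverse_real_of_nat elim
      by (intro LIMSEQ_le_const[where X = "\<lambda>n. inverse (real (Suc n))"]) (auto simp: inverse_eq_divide)
    then show ?case by simp
  qed
qed

lemma conv_in_probD:
  "conv_in_prob M X Y \<Longrightarrow> \<epsilon> > 0 \<Longrightarrow> (\<lambda>n. measure M {\<omega> \<in> space M. \<bar>X n \<omega> - Y \<omega>\<bar> > \<epsilon>}) \<longlonglongrightarrow> 0"
  by (simp add: conv_in_prob_def)

lemma (in prob_space) conv_in_prob_unique:
  assumes "conv_in_prob M X Y" "conv_in_prob M X Z"
  shows "AE \<omega> in M. Y \<omega> = Z \<omega>"
proof -
  have [measurable]: "\<And>n. X n \<in> borel_measurable M" "Y \<in> borel_measurable M" "Z \<in> borel_measurable M"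
    using assms by (auto simp: conv_in_prob_def)
  have "AE \<omega> in M. Y \<omega> - Z \<omega> = 0"
  proof (rule AE_eq_0_if_prob_eq_0)
    fix \<epsilon> :: real assume "\<epsilon> > 0"
    have "prob {\<omega> \<in> space M. \<bar>Y \<omega> - Z \<omega>\<bar> > \<epsilon>} \<le> prob {\<omega> \<in> space M. \<bar>X n \<omega> - Y \<omega>\<bar> > \<epsilon> / 2}
      + prob {\<omega> \<in> space M. \<bar>X n \<omega> - Z \<omega>\<bar> > \<epsilon> / 2}" for n
    proof (rule prob_le_add)
      show "AE \<omega> in M. \<bar>Y \<omega> - Z \<omega>\<bar> > \<epsilon> \<longrightarrow> \<bar>X n \<omega> - Y \<omega>\<bar> > \<epsilon> / 2 \<or> \<bar>X n \<omega> - Z \<omega>\<bar> > \<epsilon> / 2"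
        using abs_diff_gt_half[of \<epsilon> "Y _" "Z _" "X n _"] by (intro AE_I2) (metis abs_minus_commute)
    qed measurable
    moreover have "(\<lambda>n. prob {\<omega> \<in> space M. \<bar>X n \<omega> - Y \<omega>\<bar> > \<epsilon> / 2}
      + prob {\<omega> \<in> space M. \<bar>X n \<omega> - Z \<omega>\<bar> > \<epsilon> / 2}) \<longlonglongrightarrow> 0 + 0"
      by (intro tendsto_add conv_in_probD[OF assms(1)] conv_in_probD[OF assms(2)] half_gt_zero \<open>\<epsilon> > 0\<close>)
    ultimately have "prob {\<omega> \<in> space M. \<bar>Y \<omega> - Z \<omega>\<bar> > \<epsilon>} \<le> 0 + 0"
      by (intro LIMSEQ_le_const) auto
    then show "prob {\<omega> \<in> space M. \<bar>Y \<omega> - Z \<omega>\<bar> > \<epsilon>} = 0" by (simp add: measure_le_0_iff)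
  qed simp
  then show ?thesis by eventually_elim simp
qed

text \<open>Dominated convergence for indicators. It carries pathwise statements of the form
  "eventually" over to probabilities.\<close>

lemma (in prob_space) prob_tendsto_0_AE:
  assumes [measurable]: "\<And>n. Measurable.pred M (P n)"
    and "AE \<omega> in M. eventually (\<lambda>n. \<not> P n \<omega>) sequentially"
  shows "(\<lambda>n. prob {\<omega> \<in> space M. P n \<omega>}) \<longlonglongrightarrow> 0"
proof -
  have "(\<lambda>n. expectation (indicator {\<omega> \<in> space M. P n \<omega>} :: _ \<Rightarrow> real)) \<longlonglongrightarrow> expectation (\<lambda>_. 0)"
  proof (rule integral_dominated_convergence[where w = "\<lambda>_. 1"])
    show "AE \<omega> in M. (\<lambda>n. indicator {\<omega> \<in> space M. P n \<omega>} \<omega> :: real) \<longlonglongrightarrow> 0"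
      using assms(2)
    proof eventually_elim
      case (elim \<omega>)
      then have "\<forall>\<^sub>F n in sequentially. indicator {\<omega> \<in> space M. P n \<omega>} \<omega> = (0::real)"
        by eventually_elim simp
      then show ?case by (rule tendsto_eventually)
    qed
  qed (auto simp: indicator_def)
  then show ?thesis by simp
qed

section \<open>Consequences of \<sigma>-additivity and averaging over random subsets\<close>

context prob_space
begin

text \<open>\<open>\<mu> (A k)\<close> is the difference of two consecutive partial sums, both close
  to the value on the union. The final contradiction is with this lemma.\<close>

lemma stochastic_measure_disjoint_tendsto:
  assumes "stochastic_measure M N \<mu>" "range A \<subseteq> sets N" "disjoint_family A" "\<epsilon> > 0"
  shows "(\<lambda>k. prob {\<omega> \<in> space M. \<bar>\<mu> (A k) \<omega>\<bar> > \<epsilon>}) \<longlonglongrightarrow> 0"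
proof -
  define X where "X n \<omega> = (\<Sum>k<n. \<mu> (A k) \<omega>)" for n \<omega>
  define Y where "Y = \<mu> (\<Union>k. A k)"
  have conv: "conv_in_prob M X Y"
    using assms unfolding stochastic_measure_def X_def[abs_def] Y_def by blast
  then have [measurable]: "\<And>n. X n \<in> borel_measurable M" "Y \<in> borel_measurable M"
    by (auto simp: conv_in_prob_def)
  have lim: "(\<lambda>n. prob {\<omega> \<in> space M. \<bar>X n \<omega> - Y \<omega>\<bar> > \<epsilon> / 2}) \<longlonglongrightarrow> 0"
    by (rule conv_in_probD[OF conv half_gt_zero[OF \<open>\<epsilon> > 0\<close>]])
  have Suc: "\<mu> (A n) \<omega> = X (Suc n) \<omega> - X n \<omega>" for n \<omega> by (simp add: X_def)
  have le: "prob {\<omega> \<in> space M. \<bar>\<mu> (A n) \<omega>\<bar> > \<epsilon>} \<le> prob {\<omega> \<in> space M. \<bar>X n \<omega> - Y \<omega>\<bar> > \<epsilon> / 2}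
      + prob {\<omega> \<in> space M. \<bar>X (Suc n) \<omega> - Y \<omega>\<bar> > \<epsilon> / 2}" for n
  proof (rule prob_le_add)
    show "AE \<omega> in M. \<bar>\<mu> (A n) \<omega>\<bar> > \<epsilon> \<longrightarrow> \<bar>X n \<omega> - Y \<omega>\<bar> > \<epsilon> / 2 \<or> \<bar>X (Suc n) \<omega> - Y \<omega>\<bar> > \<epsilon> / 2"
      unfolding Suc by (intro AE_I2 impI) (subst disj_commute, rule abs_diff_gt_half)
  qed measurable
  show ?thesis
  proof (rule tendsto_sandwich[OF _ _ tendsto_const])
    show "\<forall>\<^sub>F n in sequentially. 0 \<le> prob {\<omega> \<in> space M. \<bar>\<mu> (A n) \<omega>\<bar> > \<epsilon>}" by simp
    show "\<forall>\<^sub>F n in sequentially. prob {\<omega> \<in> space M. \<bar>\<mu> (A n) \<omega>\<bar> > \<epsilon>}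
        \<le> prob {\<omega> \<in> space M. \<bar>X n \<omega> - Y \<omega>\<bar> > \<epsilon> / 2}
          + prob {\<omega> \<in> space M. \<bar>X (Suc n) \<omega> - Y \<omega>\<bar> > \<epsilon> / 2}"
      by (intro always_eventually allI le)
    show "(\<lambda>n. prob {\<omega> \<in> space M. \<bar>X n \<omega> - Y \<omega>\<bar> > \<epsilon> / 2}
        + prob {\<omega> \<in> space M. \<bar>X (Suc n) \<omega> - Y \<omega>\<bar> > \<epsilon> / 2}) \<longlonglongrightarrow> 0"
      using tendsto_add[OF lim LIMSEQ_Suc[OF lim]] by simp
  qed
qed

text \<open>The constant sequence of empty sets is disjoint, so a constant sequence of probabilities
  tends to 0.\<close>

lemma stochastic_measure_empty:
  assumes "stochastic_measure M N \<mu>"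
  shows "AE \<omega> in M. \<mu> {} \<omega> = 0"
proof (rule AE_eq_0_if_prob_eq_0)
  show "\<mu> {} \<in> borel_measurable M" using assms by (auto simp: stochastic_measure_def)
  fix \<epsilon> :: real assume "\<epsilon> > 0"
  from stochastic_measure_disjoint_tendsto[OF assms, of "\<lambda>_. {}" \<epsilon>] this
  show "prob {\<omega> \<in> space M. \<bar>\<mu> {} \<omega>\<bar> > \<epsilon>} = 0"
    by (simp add: disjoint_family_on_def LIMSEQ_const_iff)
qed

text \<open>The pair is padded with empty sets; almost surely the partial sums are constant from
  index 2 on, and limits in probability are unique.\<close>

lemma stochastic_measure_Un:
  assumes "stochastic_measure M N \<mu>" "A \<in> sets N" "B \<in> sets N" "A \<inter> B = {}"
  shows "AE \<omega> in M. \<mu> (A \<union> B) \<omega> = \<mu> A \<omega> + \<mu> B \<omega>"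
proof -
  define D :: "nat \<Rightarrow> _" where "D k = (if k = 0 then A else if k = 1 then B else {})" for k
  define X where "X n \<omega> = (\<Sum>k<n. \<mu> (D k) \<omega>)" for n \<omega>
  have [measurable]: "\<And>A. A \<in> sets N \<Longrightarrow> \<mu> A \<in> borel_measurable M"
    using assms(1) by (auto simp: stochastic_measure_def)
  have D: "range D \<subseteq> sets N" "disjoint_family D" "(\<Union>k. D k) = A \<union> B"
    using assms(2-4) by (auto simp: D_def disjoint_family_on_def split: if_splits)
  have 1: "conv_in_prob M X (\<mu> (A \<union> B))"
    using assms(1) D unfolding stochastic_measure_def X_def[abs_def] by metis
  have "AE \<omega> in M. \<forall>n\<ge>2. X n \<omega> = \<mu> A \<omega> + \<mu> B \<omega>"
    using stochastic_measure_empty[OF assms(1)]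
  proof eventually_elim
    case (elim \<omega>)
    show ?case
    proof (intro allI impI)
      fix n :: nat assume "n \<ge> 2"
      then have "X n \<omega> = (\<Sum>k\<in>{0,1}. \<mu> (D k) \<omega>)"
        unfolding X_def using elim by (intro sum.mono_neutral_right) (auto simp: D_def)
      then show "X n \<omega> = \<mu> A \<omega> + \<mu> B \<omega>" by (simp add: D_def)
    qed
  qed
  then have ev: "AE \<omega> in M. eventually (\<lambda>n. \<not> \<bar>X n \<omega> - (\<mu> A \<omega> + \<mu> B \<omega>)\<bar> > \<epsilon>) sequentially"
    if "\<epsilon> > 0" for \<epsilon>
    by eventually_elim (use that in \<open>auto intro!: eventually_sequentiallyI[of 2]\<close>)
  have X: "X n \<in> borel_measurable M" for n using 1 by (auto simp: conv_in_prob_def)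
  have "conv_in_prob M X (\<lambda>\<omega>. \<mu> A \<omega> + \<mu> B \<omega>)"
    unfolding conv_in_prob_def using assms(2,3) X ev by (auto intro!: prob_tendsto_0_AE)
  with 1 show ?thesis by (rule conv_in_prob_unique)
qed

lemma stochastic_measure_UN:
  assumes "stochastic_measure M N \<mu>" "finite S" "\<And>k. k \<in> S \<Longrightarrow> I k \<in> sets N" "disjoint_family_on I S"
  shows "AE \<omega> in M. \<mu> (\<Union>k\<in>S. I k) \<omega> = (\<Sum>k\<in>S. \<mu> (I k) \<omega>)"
  using assms(2-4)
proof (induction S rule: finite_induct)
  case empty
  then show ?case using stochastic_measure_empty[OF assms(1)] by simp
next
  case (insert a S)
  have "AE \<omega> in M. \<mu> (\<Union>k\<in>S. I k) \<omega> = (\<Sum>k\<in>S. \<mu> (I k) \<omega>)"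
    using insert by (auto simp: disjoint_family_on_def)
  moreover have "AE \<omega> in M. \<mu> (I a \<union> (\<Union>k\<in>S. I k)) \<omega> = \<mu> (I a) \<omega> + \<mu> (\<Union>k\<in>S. I k) \<omega>"
    using insert assms(1) by (intro stochastic_measure_Un) (auto simp: disjoint_family_on_def)
  ultimately show ?case by eventually_elim (use insert in simp)
qed

text \<open>Fubini for \<omega> and the random subset. It lets the moment and Markov estimates be
  made with \<omega> fixed.\<close>

lemma bern_mean_prob:
  assumes [measurable]: "\<And>S. S \<subseteq> J \<Longrightarrow> Measurable.pred M (P S)"
  shows "bern_mean p J (\<lambda>S. prob {\<omega> \<in> space M. P S \<omega>})
    = expectation (\<lambda>\<omega>. bern_mean p J (\<lambda>S. of_bool (P S \<omega>)))"
proof -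
  have *: "has_bochner_integral M (\<lambda>\<omega>. of_bool (P S \<omega>)) (prob {\<omega> \<in> space M. P S \<omega>})"
    if [simp]: "S \<subseteq> J" for S
  proof -
    have "has_bochner_integral M (indicator {\<omega> \<in> space M. P S \<omega>}) (prob {\<omega> \<in> space M. P S \<omega>})"
      by (rule has_bochner_integral_real_indicator) (auto simp: emeasure_eq_measure)
    then show ?thesis
      by (rule has_bochner_integral_cong[THEN iffD1, rotated -1]) (auto simp: indicator_def)
  qed
  have "has_bochner_integral M (\<lambda>\<omega>. bern_mean p J (\<lambda>S. of_bool (P S \<omega>)))
     (bern_mean p J (\<lambda>S. prob {\<omega> \<in> space M. P S \<omega>}))"
    unfolding bern_mean_def
    by (intro has_bochner_integral_sum has_bochner_integral_mult_right *) auto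
  then show ?thesis by (simp add: has_bochner_integral_integral_eq)
qed

end

section \<open>Sums of squares are bounded in probability\<close>

text \<open>What the argument uses of a sequence of partitions. True refinement is replaced by
  \<open>card_straddling\<close>: the number of cells of level \<open>m\<close> that fit into no
  cell of level \<open>n\<close> is bounded by \<open>b n\<close>, uniformly in \<open>m\<close>.
  Together with \<open>small\<close> this makes their contribution to later sums of squares
  negligible.\<close>

locale refining_cells = prob_space M for M :: "'a measure" +
  fixes N :: "'x measure" and \<mu> :: "'x set \<Rightarrow> 'a \<Rightarrow> real"
    and K :: "nat \<Rightarrow> 'i set" and I :: "nat \<Rightarrow> 'i \<Rightarrow> 'x set" and b :: "nat \<Rightarrow> nat"
  assumes stochastic: "stochastic_measure M N \<mu>"
    and space_N: "space N \<in> sets N"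
    and finite_K: "finite (K n)"
    and sets_I: "k \<in> K n \<Longrightarrow> I n k \<in> sets N"
    and nonempty_I: "k \<in> K n \<Longrightarrow> I n k \<noteq> {}"
    and disjoint_I: "disjoint_family_on (I n) (K n)"
    and card_straddling: "card {k \<in> K m. \<not> (\<exists>l\<in>K n. I m k \<subseteq> I n l)} \<le> b n"
    and small: "\<delta> > 0 \<Longrightarrow> (\<lambda>n. prob {\<omega> \<in> space M. \<exists>k\<in>K n. \<bar>\<mu> (I n k) \<omega>\<bar> > \<delta>}) \<longlonglongrightarrow> 0"
begin

text \<open>The restriction to cells inside \<open>G\<close> is a factor, not a smaller index set,
  so that sums over \<open>K n\<close> and over removed cells can be interchanged.\<close>

definition Q :: "nat \<Rightarrow> 'x set \<Rightarrow> 'a \<Rightarrow> real" where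
  "Q n G \<omega> = (\<Sum>k\<in>K n. of_bool (I n k \<subseteq> G) * (\<mu> (I n k) \<omega>)\<^sup>2)"

lemma Q_eq: "Q n G \<omega> = (\<Sum>k\<in>{k \<in> K n. I n k \<subseteq> G}. (\<mu> (I n k) \<omega>)\<^sup>2)"
  unfolding Q_def sum.inter_filter[OF finite_K] by (intro sum.cong) auto

text \<open>Failure of boundedness in probability, localised to \<open>G\<close> and along
  arbitrarily late partitions. The level \<epsilon> is explicit because every removal lowers
  it.\<close>

definition unbounded_on :: "'x set \<Rightarrow> real \<Rightarrow> bool" where
  "unbounded_on G \<epsilon> \<longleftrightarrow> (\<forall>C m0. \<exists>m\<ge>m0. prob {\<omega> \<in> space M. Q m G \<omega> > C} > \<epsilon>)"

lemma measurable_mu [measurable]: "A \<in> sets N \<Longrightarrow> \<mu> A \<in> borel_measurable M"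
  using stochastic by (simp add: stochastic_measure_def)

lemma measurable_mu_I [measurable]: "k \<in> K n \<Longrightarrow> \<mu> (I n k) \<in> borel_measurable M"
  by (intro measurable_mu sets_I)

lemma measurable_Q [measurable]: "Q n G \<in> borel_measurable M"
  unfolding Q_def[abs_def] by measurable

lemma measurable_small [measurable]:
  "Measurable.pred M (\<lambda>\<omega>. \<forall>k\<in>K n. \<bar>\<mu> (I n k) \<omega>\<bar> \<le> \<delta>)"
  "Measurable.pred M (\<lambda>\<omega>. \<exists>k\<in>K n. \<bar>\<mu> (I n k) \<omega>\<bar> > \<delta>)"
  using finite_K[of n] by (auto intro!: pred_intros_finite)

lemma eventually_small:
  assumes "\<delta> > 0" "\<epsilon> > 0"
  shows "\<exists>m0. \<forall>m\<ge>m0. prob {\<omega> \<in> space M. \<exists>k\<in>K m. \<bar>\<mu> (I m k) \<omega>\<bar> > \<delta>} < \<epsilon>"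
  using order_tendstoD(2)[OF small[OF assms(1)] assms(2)] by (simp add: eventually_sequentially)

text \<open>On late partitions all increments are small except with probability \<epsilon>', and
  this exceptional event is simply subtracted.\<close>

lemma unbounded_onD_small:
  assumes "unbounded_on G \<epsilon>" "\<delta> > 0" "\<epsilon>' > 0"
  shows "\<exists>m\<ge>m0. prob {\<omega> \<in> space M. Q m G \<omega> > C \<and> (\<forall>k\<in>K m. \<bar>\<mu> (I m k) \<omega>\<bar> \<le> \<delta>)} > \<epsilon> - \<epsilon>'"
proof -
  obtain m1 where m1: "\<forall>m\<ge>m1. prob {\<omega> \<in> space M. \<exists>k\<in>K m. \<bar>\<mu> (I m k) \<omega>\<bar> > \<delta>} < \<epsilon>'"
    using eventually_small[OF assms(2,3)] by blast
  obtain m where m: "m \<ge> max m0 m1" "prob {\<omega> \<in> space M. Q m G \<omega> > C} > \<epsilon>"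
    using assms(1) unfolding unbounded_on_def by blast
  have "prob {\<omega> \<in> space M. Q m G \<omega> > C} \<le>
      prob {\<omega> \<in> space M. Q m G \<omega> > C \<and> (\<forall>k\<in>K m. \<bar>\<mu> (I m k) \<omega>\<bar> \<le> \<delta>)}
    + prob {\<omega> \<in> space M. \<exists>k\<in>K m. \<bar>\<mu> (I m k) \<omega>\<bar> > \<delta>}"
    by (rule prob_le_add) (auto simp: not_less)
  then show ?thesis using m m1[rule_format, of m] by (intro exI[of _ m]) auto
qed

text \<open>Removing a union of cells of the \<open>n\<close>-th partition from \<open>G\<close>: a cell of the \<open>m\<close>-th
  partition inside \<open>G\<close> either straddles, or lies in a removed cell, or survives.\<close>

lemma Q_remove:
  assumes S: "S \<subseteq> {k \<in> K n. I n k \<subseteq> G}"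
    and \<delta>: "real (b n) * \<delta>\<^sup>2 \<le> 1" "\<forall>k\<in>K m. \<bar>\<mu> (I m k) \<omega>\<bar> \<le> \<delta>"
  shows "Q m G \<omega> \<le> 1 + (\<Sum>l\<in>S. Q m (I n l) \<omega>) + Q m (G - (\<Union>l\<in>S. I n l)) \<omega>"
proof -
  let ?x = "\<lambda>k. (\<mu> (I m k) \<omega>)\<^sup>2"
  let ?bad = "\<lambda>k. \<not> (\<exists>l\<in>K n. I m k \<subseteq> I n l)"
  have fin: "finite S" using S finite_K[of n] by (auto intro: finite_subset)
  have "Q m G \<omega> \<le> (\<Sum>k\<in>K m. of_bool (?bad k) * ?x k + (\<Sum>l\<in>S. of_bool (I m k \<subseteq> I n l) * ?x k)
      + of_bool (I m k \<subseteq> G - (\<Union>l\<in>S. I n l)) * ?x k)"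
    unfolding Q_def
  proof (intro sum_mono)
    fix k assume k: "k \<in> K m"
    let ?s = "\<Sum>l\<in>S. of_bool (I m k \<subseteq> I n l) * ?x k"
    have s: "?s \<ge> 0" by (intro sum_nonneg) auto
    consider "\<not> I m k \<subseteq> G" | "?bad k" | "I m k \<subseteq> G" "\<exists>l\<in>S. I m k \<subseteq> I n l"
      | "I m k \<subseteq> G" "\<exists>l\<in>K n - S. I m k \<subseteq> I n l" by blast
    then show "of_bool (I m k \<subseteq> G) * ?x k \<le> of_bool (?bad k) * ?x k + ?s
      + of_bool (I m k \<subseteq> G - (\<Union>l\<in>S. I n l)) * ?x k"
    proof cases
      case 3
      then obtain l where l: "l \<in> S" "I m k \<subseteq> I n l" by blast
      then have "?x k \<le> ?s"
        using fin member_le_sum[of l S "\<lambda>l. of_bool (I m k \<subseteq> I n l) * ?x k"] by auto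
      moreover have "of_bool (I m k \<subseteq> G) * ?x k = ?x k" using 3 by simp
      moreover have "0 \<le> of_bool (?bad k) * ?x k" "0 \<le> of_bool (I m k \<subseteq> G - (\<Union>l\<in>S. I n l)) * ?x k"
        by simp_all
      ultimately show ?thesis by linarith
    next
      case 4
      then obtain l where l: "l \<in> K n" "l \<notin> S" "I m k \<subseteq> I n l" by blast
      have "I n l \<inter> I n l' = {}" if "l' \<in> S" for l'
      proof -
        have "l' \<in> K n" "l \<noteq> l'" using l that S by auto
        then show ?thesis using disjoint_I[of n] l(1) unfolding disjoint_family_on_def by blast
      qed
      then have "I m k \<subseteq> G - (\<Union>l\<in>S. I n l)" using l 4 by blast
      then show ?thesis using s 4 by auto
    qed (use s in auto)
  qed
  also have "\<dots> = (\<Sum>k\<in>{k\<in>K m. ?bad k}. ?x k) + (\<Sum>l\<in>S. Q m (I n l) \<omega>) + Q m (G - (\<Union>l\<in>S. I n l)) \<omega>"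
  proof -
    have "(\<Sum>k\<in>{k\<in>K m. ?bad k}. ?x k) = (\<Sum>k\<in>K m. of_bool (?bad k) * ?x k)"
      unfolding sum.inter_filter[OF finite_K] by (intro sum.cong) auto
    moreover have "(\<Sum>l\<in>S. Q m (I n l) \<omega>) = (\<Sum>k\<in>K m. \<Sum>l\<in>S. of_bool (I m k \<subseteq> I n l) * ?x k)"
      unfolding Q_def by (rule sum.swap)
    ultimately show ?thesis unfolding Q_def sum.distrib by simp
  qed
  \<comment> \<open>At most \<open>b n\<close> straddling cells, each with square at most
    \<delta>^2; the summand 1 in the statement pays for all of them.\<close>
  also have "(\<Sum>k\<in>{k\<in>K m. ?bad k}. ?x k) \<le> real (card {k\<in>K m. ?bad k}) * \<delta>\<^sup>2"
  proof (rule sum_bounded_above)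
    fix k assume "k \<in> {k\<in>K m. ?bad k}"
    then have "\<bar>\<mu> (I m k) \<omega>\<bar> \<le> \<delta>" using \<delta>(2) by blast
    from power_mono[OF this, of 2] show "?x k \<le> \<delta>\<^sup>2" by simp
  qed
  also have "\<dots> \<le> real (b n) * \<delta>\<^sup>2" using card_straddling by (intro mult_right_mono) auto
  also have "\<dots> \<le> 1" by (rule \<delta>(1))
  finally show ?thesis by simp
qed

text \<open>The cells of level \<open>n\<close> are disjoint and a cell of level \<open>m\<close> is
  nonempty, so it lies in at most one of them and is counted at most once.\<close>

lemma sum_Q_le:
  assumes "J \<subseteq> {k \<in> K n. I n k \<subseteq> G}"
  shows "(\<Sum>l\<in>J. Q m (I n l) \<omega>) \<le> Q m G \<omega>"
proof -
  have fin: "finite J" using assms finite_K[of n] by (auto intro: finite_subset)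
  have "(\<Sum>l\<in>J. Q m (I n l) \<omega>) = (\<Sum>k\<in>K m. (\<Sum>l\<in>J. of_bool (I m k \<subseteq> I n l)) * (\<mu> (I m k) \<omega>)\<^sup>2)"
    unfolding Q_def sum_distrib_right by (rule sum.swap)
  also have "\<dots> \<le> Q m G \<omega>" unfolding Q_def
  proof (intro sum_mono mult_right_mono)
    fix k assume k: "k \<in> K m"
    show "(\<Sum>l\<in>J. of_bool (I m k \<subseteq> I n l)) \<le> (of_bool (I m k \<subseteq> G) :: real)"
    proof (cases "\<exists>l\<in>J. I m k \<subseteq> I n l")
      case True
      then obtain l where l: "l \<in> J" "I m k \<subseteq> I n l" by blast
      have "\<not> I m k \<subseteq> I n l'" if "l' \<in> J - {l}" for l'
      proof -
        have "I n l \<inter> I n l' = {}"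
          using disjoint_I[of n] l that assms unfolding disjoint_family_on_def by blast
        then show ?thesis using l nonempty_I[OF k] by blast
      qed
      then have "(\<Sum>l\<in>J. of_bool (I m k \<subseteq> I n l) :: real) = (\<Sum>l\<in>{l}. of_bool (I m k \<subseteq> I n l))"
        using fin l by (intro sum.mono_neutral_right) auto
      also have "\<dots> \<le> real (card {l}) * 1" by (rule sum_bounded_above) auto
      finally show ?thesis using l assms by auto
    qed (auto simp: sum_nonneg)
  qed auto
  finally show ?thesis .
qed

text \<open>Two demands compete: \<open>R\<close> must carry a large value of \<mu>, yet absorb
  little of the later sums of squares. A random choice with tiny \<open>p\<close> meets both,
  because unboundedness on \<open>G\<close> supplies sums of squares large enough to compensate for
  \<open>p\<close>. One deterministic choice is extracted from the mean of
  \<open>h S - 2 / \<eta> * g S\<close>, gain minus weighted loss.\<close>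

lemma unbounded_on_step:
  assumes G: "G \<in> sets N" and U: "unbounded_on G \<epsilon>" and \<eta>: "0 < \<eta>" "\<eta> \<le> 1" and \<epsilon>: "0 < \<epsilon>"
  shows "\<exists>R\<in>sets N. R \<subseteq> G \<and> \<epsilon> / 512 \<le> prob {\<omega> \<in> space M. \<bar>\<mu> R \<omega>\<bar> > 1} \<and> unbounded_on (G - R) (\<epsilon> - \<eta>)"
proof -
  have "\<epsilon> < 1"
  proof -
    obtain m where "prob {\<omega> \<in> space M. Q m G \<omega> > 0} > \<epsilon>" using U unfolding unbounded_on_def by blast
    then show ?thesis using prob_le_1[of "{\<omega> \<in> space M. Q m G \<omega> > 0}"] by linarith
  qed
  \<comment> \<open>The value for which the mean loss 2 p, weighted by 2 / \<eta>, equals \<epsilon>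
    / 512, half of the mean gain \<epsilon> / 256.\<close>
  define p where "p = \<eta> * \<epsilon> / 2048"
  have p: "0 < p" "p < 1"
    using \<eta> \<epsilon> \<open>\<epsilon> < 1\<close> mult_mono[of \<eta> 1 \<epsilon> 1] by (auto simp: p_def)
  have v: "0 < p * (1 - p)" using p by simp
  \<comment> \<open>The threshold at which the variance of the random sum reaches 2.\<close>
  define L where "L = 2 / (p * (1 - p))"
  obtain n where n: "prob {\<omega> \<in> space M. Q n G \<omega> > L \<and> (\<forall>k\<in>K n. \<bar>\<mu> (I n k) \<omega>\<bar> \<le> 1)} > \<epsilon> - \<epsilon> / 2"
    using unbounded_onD_small[OF U, of 1 "\<epsilon> / 2" 0 L] \<epsilon> by auto
  define J where "J = {k \<in> K n. I n k \<subseteq> G}"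
  have J: "finite J" using finite_K by (simp add: J_def)
  define R where "R S = (\<Union>l\<in>S. I n l)" for S
  have S_sets: "finite S" "R S \<in> sets N" "R S \<subseteq> G" if "S \<subseteq> J" for S
  proof -
    show "finite S" using that J by (rule finite_subset)
    then show "R S \<in> sets N" unfolding R_def
      using that sets_I by (intro sets.finite_UN) (auto simp: J_def)
    show "R S \<subseteq> G" using that by (auto simp: R_def J_def)
  qed
  define h where "h S = prob {\<omega> \<in> space M. 1 < \<bar>\<Sum>k\<in>S. \<mu> (I n k) \<omega>\<bar>}" for S
  have h: "prob {\<omega> \<in> space M. \<bar>\<mu> (R S) \<omega>\<bar> > 1} = h S" if S: "S \<subseteq> J" for S
    unfolding h_def
  proof (rule measure_eq_AE)
    have SK: "S \<subseteq> K n" using S by (auto simp: J_def)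
    have "AE \<omega> in M. \<mu> (R S) \<omega> = (\<Sum>k\<in>S. \<mu> (I n k) \<omega>)"
      unfolding R_def using SK disjoint_family_on_mono[OF SK disjoint_I] sets_I S_sets(1)[OF S]
      by (intro stochastic_measure_UN[OF stochastic]) auto
    then show "AE \<omega> in M. (\<omega> \<in> {\<omega> \<in> space M. \<bar>\<mu> (R S) \<omega>\<bar> > 1}) = (\<omega> \<in> {\<omega> \<in> space M. 1 < \<bar>\<Sum>k\<in>S. \<mu> (I n k) \<omega>\<bar>})"
      by eventually_elim simp
    have [measurable]: "\<mu> (R S) \<in> borel_measurable M" "\<And>k. k \<in> S \<Longrightarrow> \<mu> (I n k) \<in> borel_measurable M"
      using S_sets[OF S] SK by auto
    show "{\<omega> \<in> space M. \<bar>\<mu> (R S) \<omega>\<bar> > 1} \<in> sets M" by measurable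
    show "{\<omega> \<in> space M. 1 < \<bar>\<Sum>k\<in>S. \<mu> (I n k) \<omega>\<bar>} \<in> sets M" by measurable
  qed
  \<comment> \<open>The lower bound 1/128 holds for each \<omega> in an event of probability above
    \<epsilon> / 2.\<close>
  have mean_h: "\<epsilon> / 256 \<le> bern_mean p J h"
  proof -
    let ?E = "{\<omega> \<in> space M. Q n G \<omega> > L \<and> (\<forall>k\<in>K n. \<bar>\<mu> (I n k) \<omega>\<bar> \<le> 1)}"
    let ?B = "\<lambda>\<omega>. bern_mean p J (\<lambda>S. of_bool (1 < \<bar>\<Sum>k\<in>S. \<mu> (I n k) \<omega>\<bar>))"
    have meas: "Measurable.pred M (\<lambda>\<omega>. 1 < \<bar>\<Sum>k\<in>S. \<mu> (I n k) \<omega>\<bar>)" if S: "S \<subseteq> J" for S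
    proof -
      have [measurable]: "\<And>k. k \<in> S \<Longrightarrow> \<mu> (I n k) \<in> borel_measurable M" using S by (auto simp: J_def)
      show ?thesis by measurable
    qed
    have B: "0 \<le> ?B \<omega>" "?B \<omega> \<le> 1" for \<omega>
    proof -
      have "bern_mean p J (\<lambda>_. 0) \<le> ?B \<omega>" "?B \<omega> \<le> bern_mean p J (\<lambda>_. 1)"
        using p by (auto intro!: bern_mean_mono)
      then show "0 \<le> ?B \<omega>" "?B \<omega> \<le> 1" using J by (auto simp: bern_mean_const)
    qed
    have meas_B: "?B \<in> borel_measurable M"
      unfolding bern_mean_def using meas by (intro borel_measurable_sum borel_measurable_times) auto
    have "\<epsilon> / 256 \<le> expectation (\<lambda>\<omega>. 1 / 128 * indicator ?E \<omega>)"
      using n by simp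
    also have "\<dots> \<le> expectation ?B"
    proof (rule integral_mono)
      show "integrable M ?B"
        by (rule integrable_const_bound[where B = 1]) (use B meas_B in auto)
      fix \<omega>
      show "1 / 128 * indicator ?E \<omega> \<le> ?B \<omega>"
      proof (cases "\<omega> \<in> ?E")
        case True
        have "L \<le> (\<Sum>k\<in>J. (\<mu> (I n k) \<omega>)\<^sup>2)"
          using True finite_K[of n]
          by (simp add: Q_eq J_def)
        then have "p * (1 - p) * L \<le> p * (1 - p) * (\<Sum>k\<in>J. (\<mu> (I n k) \<omega>)\<^sup>2)"
          using v by (intro mult_left_mono) auto
        moreover have "p * (1 - p) * L = 2" using v p by (simp add: L_def)
        ultimately have "1 / 128 \<le> ?B \<omega>"
          using p J True by (intro bern_mean_paley_zygmund) (auto simp: J_def)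
        then show ?thesis using True by simp
      qed (use B in simp)
      have "?E \<in> sets M" by measurable
      then show "integrable M (\<lambda>\<omega>. 1 / 128 * indicator ?E \<omega> :: real)"
        by (intro integrable_mult_right integrable_real_indicator) (auto simp: emeasure_eq_measure)
    qed
    also have "\<dots> = bern_mean p J h" unfolding h_def by (rule bern_mean_prob[OF meas, symmetric])
    finally show ?thesis .
  qed
  \<comment> \<open>\<open>S\<close> depends on \<open>i\<close> through the later partition
    \<open>m\<close>; \<open>n\<close>, and with it the finite set \<open>J\<close>, does
    not.\<close>
  have ex: "\<exists>S. S \<subseteq> J \<and> \<epsilon> / 512 \<le> h S \<and> (\<exists>m\<ge>i. prob {\<omega> \<in> space M. Q m (G - R S) \<omega> > real i} > \<epsilon> - \<eta>)" for i
  proof -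
    define \<delta> where "\<delta> = 1 / (real (b n) + 1)"
    have \<delta>: "0 < \<delta>" "real (b n) * \<delta>\<^sup>2 \<le> 1"
    proof -
      show "0 < \<delta>" by (simp add: \<delta>_def)
      have "real (b n) * \<delta> \<le> 1" "\<delta> \<le> 1" by (auto simp: \<delta>_def)
      then have "(real (b n) * \<delta>) * \<delta> \<le> 1 * 1" using \<open>0 < \<delta>\<close> by (intro mult_mono) auto
      then show "real (b n) * \<delta>\<^sup>2 \<le> 1" by (simp add: power2_eq_square mult_ac)
    qed
    \<comment> \<open>If at most \<open>i\<close> remains outside \<open>R S\<close>, at most 1
      straddles and the total exceeds 2 i + 2, then the removed cells hold more than half of the
      total, which is the event bounded by Markov's inequality.\<close>
    obtain m where m: "m \<ge> i" "prob {\<omega> \<in> space M. Q m G \<omega> > 2 * real i + 2 \<and> (\<forall>k\<in>K m. \<bar>\<mu> (I m k) \<omega>\<bar> \<le> \<delta>)} > \<epsilon> - \<eta> / 2"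
      using unbounded_onD_small[OF U \<delta>(1), of "\<eta> / 2"] \<eta> by (meson half_gt_zero)
    let ?H = "\<lambda>\<omega>. Q m G \<omega> > 2 * real i + 2 \<and> (\<forall>k\<in>K m. \<bar>\<mu> (I m k) \<omega>\<bar> \<le> \<delta>)"
    define g where "g S = prob {\<omega> \<in> space M. ?H \<omega> \<and> Q m (G - R S) \<omega> \<le> real i}" for S
    have "bern_mean p J g = expectation (\<lambda>\<omega>. bern_mean p J (\<lambda>S. of_bool (?H \<omega> \<and> Q m (G - R S) \<omega> \<le> real i)))"
      unfolding g_def by (rule bern_mean_prob) measurable
    also have "\<dots> \<le> expectation (\<lambda>_. 2 * p)"
    proof (rule integral_mono_AE')
      show "AE \<omega> in M. bern_mean p J (\<lambda>S. of_bool (?H \<omega> \<and> Q m (G - R S) \<omega> \<le> real i)) \<le> 2 * p"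
      proof (intro AE_I2)
        fix \<omega>
        show "bern_mean p J (\<lambda>S. of_bool (?H \<omega> \<and> Q m (G - R S) \<omega> \<le> real i)) \<le> 2 * p"
        proof (cases "?H \<omega>")
          case True
          have "bern_mean p J (\<lambda>S. of_bool (?H \<omega> \<and> Q m (G - R S) \<omega> \<le> real i))
             \<le> bern_mean p J (\<lambda>S. of_bool (Q m G \<omega> / 2 < (\<Sum>l\<in>S. Q m (I n l) \<omega>)))"
          proof (intro bern_mean_mono)
            fix S assume "S \<subseteq> J"
            then have "Q m G \<omega> \<le> 1 + (\<Sum>l\<in>S. Q m (I n l) \<omega>) + Q m (G - R S) \<omega>"
              unfolding R_def using True \<delta> by (intro Q_remove) (auto simp: J_def)
            then have "Q m (G - R S) \<omega> \<le> real i \<longrightarrow> Q m G \<omega> / 2 < (\<Sum>l\<in>S. Q m (I n l) \<omega>)"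
              using True by linarith
            then show "(of_bool (?H \<omega> \<and> Q m (G - R S) \<omega> \<le> real i) :: real)
              \<le> of_bool (Q m G \<omega> / 2 < (\<Sum>l\<in>S. Q m (I n l) \<omega>))" by simp
          qed (use p in auto)
          also have "\<dots> \<le> 2 * p"
            using p J True by (intro bern_mean_markov sum_Q_le) (auto simp: J_def Q_def sum_nonneg)
          finally show ?thesis .
        next
          case False
          then have "bern_mean p J (\<lambda>S. of_bool (?H \<omega> \<and> Q m (G - R S) \<omega> \<le> real i)) = bern_mean p J (\<lambda>S. 0)"
            by (intro bern_mean_cong) auto
          then show ?thesis using p J by (simp add: bern_mean_const)
        qed
      qed
    qed (use p in auto)
    also have "\<dots> = 2 * p" by (simp add: prob_space)
    \<comment> \<open>Averaging the combination, not the two quantities separately, yields a single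
      \<open>S\<close>: as \<open>g S\<close> is nonnegative, \<open>h S\<close> is at least
      \<epsilon> / 512, and as \<open>h S\<close> is at most 1, \<open>g S\<close> is at most \<eta>
      / 2.\<close>
    finally have "bern_mean p J (\<lambda>S. h S - 2 / \<eta> * g S) \<ge> \<epsilon> / 256 - 2 / \<eta> * (2 * p)"
      using mean_h \<eta> by (simp only: bern_mean_diff bern_mean_cmult) (intro diff_mono mult_left_mono; simp)
    also have "\<epsilon> / 256 - 2 / \<eta> * (2 * p) = \<epsilon> / 512" using \<eta> by (simp add: p_def)
    finally obtain S where S: "S \<subseteq> J" "\<epsilon> / 512 \<le> h S - 2 / \<eta> * g S"
      using bern_mean_exists_ge[OF J, of p "\<epsilon> / 512" "\<lambda>S. h S - 2 / \<eta> * g S"] p by auto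
    have g: "0 \<le> g S" by (simp add: g_def)
    have h_ge: "\<epsilon> / 512 \<le> h S" using S(2) g \<eta> by (smt (verit) divide_nonneg_nonneg mult_nonneg_nonneg)
    have "2 / \<eta> * g S \<le> 1" using S(2) \<epsilon> prob_le_1 unfolding h_def by (smt (verit) divide_nonneg_nonneg)
    then have g_le: "g S \<le> \<eta> / 2" using \<eta> by (simp add: field_simps)
    have "prob {\<omega> \<in> space M. ?H \<omega>} \<le> prob {\<omega> \<in> space M. Q m (G - R S) \<omega> > real i} + g S"
      unfolding g_def by (rule prob_le_add) auto
    then have "prob {\<omega> \<in> space M. Q m (G - R S) \<omega> > real i} > \<epsilon> - \<eta>" using m(2) g_le by linarith
    then show ?thesis using S(1) h_ge m(1) by blast
  qed
  then obtain S where S: "\<And>i. S i \<subseteq> J" "\<And>i. \<epsilon> / 512 \<le> h (S i)"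
      "\<And>i. \<exists>m\<ge>i. prob {\<omega> \<in> space M. Q m (G - R (S i)) \<omega> > real i} > \<epsilon> - \<eta>"
    by metis
  \<comment> \<open>Pigeonhole over the finitely many subsets of \<open>J\<close>: one set works for
    infinitely many \<open>i\<close>, hence for every bound and arbitrarily late partitions.\<close>
  have "finite (range S)" using S(1) J by (intro finite_subset[of "range S" "Pow J"]) auto
  then obtain i0 where "infinite {i \<in> UNIV. S i = S i0}"
    using pigeonhole_infinite[of "UNIV :: nat set" S] by auto
  then have inf: "\<exists>i\<ge>i1. S i = S i0" for i1
    by (auto simp: infinite_nat_iff_unbounded_le)
  have "unbounded_on (G - R (S i0)) (\<epsilon> - \<eta>)"
    unfolding unbounded_on_def
  proof (intro allI)
    fix C :: real and m0 :: nat
    obtain i where i: "i \<ge> max m0 (nat \<lceil>C\<rceil>)" "S i = S i0" using inf by blast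
    obtain m where m: "m \<ge> i" "prob {\<omega> \<in> space M. Q m (G - R (S i)) \<omega> > real i} > \<epsilon> - \<eta>"
      using S(3) by blast
    have "C \<le> real i" using i by linarith
    then have "prob {\<omega> \<in> space M. Q m (G - R (S i)) \<omega> > real i} \<le> prob {\<omega> \<in> space M. Q m (G - R (S i)) \<omega> > C}"
      by (intro finite_measure_mono) auto
    then show "\<exists>m\<ge>m0. \<epsilon> - \<eta> < prob {\<omega> \<in> space M. C < Q m (G - R (S i0)) \<omega>}"
      using i m by (intro exI[of _ m]) auto
  qed
  then show ?thesis
    using S(1,2)[of i0] S_sets[of "S i0"] h[of "S i0"] by (intro bexI[of _ "R (S i0)"]) auto
qed

theorem quadratic_sums_bounded:
  assumes "\<epsilon> > 0"
  shows "\<exists>C m0. \<forall>m\<ge>m0. prob {\<omega> \<in> space M. (\<Sum>k\<in>K m. (\<mu> (I m k) \<omega>)\<^sup>2) > C} \<le> \<epsilon>"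
proof (rule ccontr)
  assume *: "\<not> ?thesis"
  have "Q m (space N) \<omega> = (\<Sum>k\<in>K m. (\<mu> (I m k) \<omega>)\<^sup>2)" for m \<omega>
    unfolding Q_eq using sets.sets_into_space[OF sets_I] by (intro sum.cong) auto
  moreover have "\<forall>C m0. \<exists>m\<ge>m0. prob {\<omega> \<in> space M. (\<Sum>k\<in>K m. (\<mu> (I m k) \<omega>)\<^sup>2) > C} > \<epsilon>"
    using * unfolding not_ex not_all not_imp not_le by blast
  ultimately have U0: "unbounded_on (space N) \<epsilon>"
    by (simp add: unbounded_on_def)
  \<comment> \<open>Levels decreasing from \<epsilon> towards \<epsilon> / 2. Their differences are
    the admissible losses \<eta>, and each removed set keeps probability at least \<epsilon> /
    1024.\<close>
  define e where "e n = \<epsilon> / 2 + \<epsilon> / 2 * (1 / 2) ^ n" for n :: nat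
  have e: "e n > 0" "\<epsilon> / 2 \<le> e n" for n using assms by (auto simp: e_def add_pos_pos)
  have "\<exists>G. \<forall>n. (G n \<in> sets N \<and> unbounded_on (G n) (e n)) \<and>
     (\<exists>R\<in>sets N. R \<subseteq> G n \<and> e n / 512 \<le> prob {\<omega> \<in> space M. \<bar>\<mu> R \<omega>\<bar> > 1} \<and> G (Suc n) = G n - R)"
  proof (rule dependent_nat_choice)
    show "\<exists>G. G \<in> sets N \<and> unbounded_on G (e 0)"
      using U0 space_N by (auto simp: e_def)
    fix G n assume G: "G \<in> sets N \<and> unbounded_on G (e n)"
    define \<eta> where "\<eta> = min 1 (e n - e (Suc n))"
    have \<eta>: "0 < \<eta>" "\<eta> \<le> 1" "e (Suc n) \<le> e n - \<eta>" using assms by (auto simp: \<eta>_def e_def)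
    obtain R where R: "R \<in> sets N" "R \<subseteq> G" "e n / 512 \<le> prob {\<omega> \<in> space M. \<bar>\<mu> R \<omega>\<bar> > 1}"
      "unbounded_on (G - R) (e n - \<eta>)"
      using unbounded_on_step[OF conjunct1[OF G] conjunct2[OF G] \<eta>(1,2) e(1)] by (elim bexE conjE)
    from R(4) have "unbounded_on (G - R) (e (Suc n))"
      unfolding unbounded_on_def using le_less_trans[OF \<eta>(3)] by blast
    then show "\<exists>G'. (G' \<in> sets N \<and> unbounded_on G' (e (Suc n))) \<and> (\<exists>R\<in>sets N. R \<subseteq> G \<and>
       e n / 512 \<le> prob {\<omega> \<in> space M. \<bar>\<mu> R \<omega>\<bar> > 1} \<and> G' = G - R)"
      using R G by (intro exI[of _ "G - R"]) auto
  qed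
  then obtain G where G: "\<forall>n. \<exists>R. R \<in> sets N \<and> R \<subseteq> G n \<and>
      e n / 512 \<le> prob {\<omega> \<in> space M. \<bar>\<mu> R \<omega>\<bar> > 1} \<and> G (Suc n) = G n - R"
    by (auto simp only: Bex_def)
  obtain R where "\<forall>n. R n \<in> sets N \<and> R n \<subseteq> G n \<and>
      e n / 512 \<le> prob {\<omega> \<in> space M. \<bar>\<mu> (R n) \<omega>\<bar> > 1} \<and> G (Suc n) = G n - R n"
    using choice[OF G] by (elim exE)
  then have R: "\<And>n. R n \<in> sets N" "\<And>n. R n \<subseteq> G n"
      "\<And>n. e n / 512 \<le> prob {\<omega> \<in> space M. \<bar>\<mu> (R n) \<omega>\<bar> > 1}" "\<And>n. G (Suc n) = G n - R n"
    by simp_all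
  have G_mono: "G n \<subseteq> G m" if "m \<le> n" for m n
    using that by (induction rule: dec_induct) (use R(4) in auto)
  \<comment> \<open>\<open>R n\<close> lies in \<open>G n\<close>, which is contained in
    \<open>G (Suc m)\<close>, and \<open>R m\<close> has been taken out of the latter.\<close>
  have disj: "R m \<inter> R n = {}" if "m < n" for m n
    using R(2)[of n] R(4)[of m] G_mono[of "Suc m" n] that by auto
  have "disjoint_family R"
    unfolding disjoint_family_on_def using disj by (metis Int_commute linorder_neqE_nat)
  then have "(\<lambda>n. prob {\<omega> \<in> space M. \<bar>\<mu> (R n) \<omega>\<bar> > 1}) \<longlonglongrightarrow> 0"
    using R(1) by (intro stochastic_measure_disjoint_tendsto[OF stochastic]) auto
  moreover have "\<epsilon> / 1024 \<le> prob {\<omega> \<in> space M. \<bar>\<mu> (R n) \<omega>\<bar> > 1}" for n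
    using R(3)[of n] e(2)[of n] by linarith
  ultimately have "\<epsilon> / 1024 \<le> 0" by (intro LIMSEQ_le_const) auto
  then show False using assms by simp
qed

end

section \<open>Riemann--Stieltjes integrals\<close>

lemma partition_points_mono:
  assumes "partition_points a b n t" "k \<le> l" "l \<le> n"
  shows "t k \<le> t l"
  using assms(2,3)
proof (induction l rule: dec_induct)
  case (step l)
  then have "t l < t (Suc l)" using assms(1) by (auto simp: partition_points_def)
  then show ?case using step by simp
qed simp

lemma partition_points_mem:
  assumes "partition_points a b n t" "k \<le> n"
  shows "t k \<in> {a..b}"
  using partition_points_mono[OF assms(1), of 0 k] partition_points_mono[OF assms(1), of k n] assms
  by (auto simp: partition_points_def)

lemma partition_points_less:
  assumes "partition_points a b n t" "k \<in> {1..n}"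
  shows "t (k - 1) < t k"
  using assms by (cases k) (auto simp: partition_points_def)

lemma diff_le_mesh: "k \<in> {1..n} \<Longrightarrow> t k - t (k - 1) \<le> mesh n t"
  unfolding mesh_def by (intro Max_ge) auto

lemma sum_telescope_pred:
  fixes n :: nat
  shows "(\<Sum>k=1..n. g k - g (k - 1)) = g n - (g 0 :: 'a :: ab_group_add)"
  by (induction n) (auto simp: algebra_simps)

definition uniform_partition :: "real \<Rightarrow> real \<Rightarrow> nat \<Rightarrow> nat \<Rightarrow> real" where
  "uniform_partition a b n k = a + (b - a) * real k / real n"

lemma partition_points_uniform:
  "a < b \<Longrightarrow> n > 0 \<Longrightarrow> partition_points a b n (uniform_partition a b n)"
  by (auto simp: partition_points_def uniform_partition_def divide_strict_right_mono)

lemma mesh_uniform: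
  assumes "n > 0"
  shows "mesh n (uniform_partition a b n) = (b - a) / real n"
proof -
  have "(\<lambda>k. uniform_partition a b n k - uniform_partition a b n (k - 1)) ` {1..n} = (\<lambda>k. (b - a) / real n) ` {1..n}"
  proof (intro image_cong refl)
    fix k assume "k \<in> {1..n}"
    then have "real (k - 1) = real k - 1" by auto
    then show "uniform_partition a b n k - uniform_partition a b n (k - 1) = (b - a) / real n"
      using assms by (simp add: uniform_partition_def field_simps)
  qed
  then show ?thesis using assms by (simp add: mesh_def image_constant_conv)
qed

lemma mesh_uniform_tendsto: "(\<lambda>i. mesh (Suc i) (uniform_partition a b (Suc i))) \<longlonglongrightarrow> 0"
  using LIMSEQ_Suc[OF lim_const_over_n[of "b - a"]] by (simp add: mesh_uniform)

lemma fine_partition_exists: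
  assumes "a < b" "\<delta> > 0"
  obtains n t where "partition_points a b n t" "mesh n t < \<delta>"
proof -
  obtain i where "mesh (Suc i) (uniform_partition a b (Suc i)) < \<delta>"
    using order_tendstoD(2)[OF mesh_uniform_tendsto[of a b] assms(2)] by (auto simp: eventually_sequentially)
  then show ?thesis using partition_points_uniform[OF assms(1)] that by blast
qed

section \<open>Dependence on the integrand, uniqueness and existence\<close>

lemma stieltjes_sum_diff_le:
  fixes p q v :: "real \<Rightarrow> real"
  assumes "partition_points a b n t" "\<forall>k\<in>{1..n}. s k \<in> {t (k - 1)..t k}"
    and "\<And>x. x \<in> {a..b} \<Longrightarrow> \<bar>p x - q x\<bar> \<le> e" "0 \<le> e"
    and B: "\<And>n t. partition_points a b n t \<Longrightarrow> (\<Sum>k=1..n. \<bar>v (t k) - v (t (k - 1))\<bar>) \<le> B"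
  shows "\<bar>(\<Sum>k=1..n. p (s k) * (v (t k) - v (t (k - 1)))) - (\<Sum>k=1..n. q (s k) * (v (t k) - v (t (k - 1))))\<bar> \<le> e * B"
proof -
  have "\<bar>(\<Sum>k=1..n. p (s k) * (v (t k) - v (t (k - 1)))) - (\<Sum>k=1..n. q (s k) * (v (t k) - v (t (k - 1))))\<bar>
      = \<bar>\<Sum>k=1..n. (p (s k) - q (s k)) * (v (t k) - v (t (k - 1)))\<bar>"
    by (simp only: left_diff_distrib sum_subtractf)
  also have "\<dots> \<le> (\<Sum>k=1..n. e * \<bar>v (t k) - v (t (k - 1))\<bar>)"
  proof (intro order.trans[OF sum_abs] sum_mono)
    fix k assume k: "k \<in> {1..n}"
    then have "s k \<in> {t (k - 1)..t k}" using assms(2) by blast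
    moreover have "t (k - 1) \<in> {a..b}" "t k \<in> {a..b}" 
      using k by (auto intro!: partition_points_mem[OF assms(1)] simp del: atLeastAtMost_iff simp: atLeastAtMost_iff[where 'a = nat])
    ultimately have "s k \<in> {a..b}" by auto
    then have "\<bar>p (s k) - q (s k)\<bar> \<le> e" by (rule assms(3))
    then show "\<bar>(p (s k) - q (s k)) * (v (t k) - v (t (k - 1)))\<bar> \<le> e * \<bar>v (t k) - v (t (k - 1))\<bar>"
      by (simp add: abs_mult mult_right_mono)
  qed
  also have "\<dots> = e * (\<Sum>k=1..n. \<bar>v (t k) - v (t (k - 1))\<bar>)" by (simp add: sum_distrib_left)
  also have "\<dots> \<le> e * B" using B[OF assms(1)] assms(4) by (intro mult_left_mono)
  finally show ?thesis .
qed

text \<open>Both integrals are approximated on one common fine partition with right endpoints as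
  tags. With equal integrands and e = 0 it gives uniqueness; with uniform approximants it gives the
  Cauchy property.\<close>

lemma has_stieltjes_integral_diff_le:
  assumes ab: "a < b" and "has_stieltjes_integral p v a b J" "has_stieltjes_integral q v a b J'"
    and e: "\<And>x. x \<in> {a..b} \<Longrightarrow> \<bar>p x - q x\<bar> \<le> e" "0 \<le> e"
    and B: "\<And>n t. partition_points a b n t \<Longrightarrow> (\<Sum>k=1..n. \<bar>v (t k) - v (t (k - 1))\<bar>) \<le> B"
  shows "\<bar>J - J'\<bar> \<le> e * B"
proof (rule field_le_epsilon)
  fix \<epsilon> :: real assume "\<epsilon> > 0"
  then have \<epsilon>2: "\<epsilon> / 2 > 0" by simp
  obtain \<delta>1 where \<delta>1: "\<delta>1 > 0" "\<And>n t s. partition_points a b n t \<Longrightarrow> mesh n t < \<delta>1 \<Longrightarrow> \<forall>k\<in>{1..n}. s k \<in> {t (k - 1)..t k} \<Longrightarrow>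
        \<bar>(\<Sum>k=1..n. p (s k) * (v (t k) - v (t (k - 1)))) - J\<bar> < \<epsilon> / 2"
    using assms(2) \<epsilon>2 unfolding has_stieltjes_integral_def by meson
  obtain \<delta>2 where \<delta>2: "\<delta>2 > 0" "\<And>n t s. partition_points a b n t \<Longrightarrow> mesh n t < \<delta>2 \<Longrightarrow> \<forall>k\<in>{1..n}. s k \<in> {t (k - 1)..t k} \<Longrightarrow>
        \<bar>(\<Sum>k=1..n. q (s k) * (v (t k) - v (t (k - 1)))) - J'\<bar> < \<epsilon> / 2"
    using assms(3) \<epsilon>2 unfolding has_stieltjes_integral_def by meson
  obtain n t where nt: "partition_points a b n t" "mesh n t < min \<delta>1 \<delta>2"
    using fine_partition_exists[OF ab, of "min \<delta>1 \<delta>2"] \<delta>1 \<delta>2 by auto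
  have s: "\<forall>k\<in>{1..n}. t k \<in> {t (k - 1)..t k}"
    using partition_points_less[OF nt(1)] by (auto intro!: less_imp_le)
  show "\<bar>J - J'\<bar> \<le> e * B + \<epsilon>"
    using \<delta>1(2)[OF nt(1) _ s] \<delta>2(2)[OF nt(1) _ s] stieltjes_sum_diff_le[where p = p and q = q and v = v, OF nt(1) s e B] nt(2) by linarith
qed

lemma has_stieltjes_integral_unique:
  assumes "a < b" "bounded_variation a b v"
    and "has_stieltjes_integral g v a b J" "has_stieltjes_integral g v a b J'"
  shows "J = J'"
proof -
  obtain B where "\<And>n t. partition_points a b n t \<Longrightarrow> (\<Sum>k=1..n. \<bar>v (t k) - v (t (k - 1))\<bar>) \<le> B"
    using assms(2) unfolding bounded_variation_def by blast
  then have "\<bar>J - J'\<bar> \<le> 0 * B"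
    using assms by (intro has_stieltjes_integral_diff_le) auto
  then show ?thesis by simp
qed

text \<open>Summation by parts turns the Riemann--Stieltjes sums into Riemann sums of \<open>v p'\<close>.\<close>

lemma has_stieltjes_integral_C1:
  fixes p p' v :: "real \<Rightarrow> real"
  assumes ab: "a < b" and v: "continuous_on {a..b} v"
    and p: "\<And>x. (p has_real_derivative p' x) (at x)" and p': "continuous_on {a..b} p'"
    and B: "\<And>n t. partition_points a b n t \<Longrightarrow> (\<Sum>k=1..n. \<bar>v (t k) - v (t (k - 1))\<bar>) \<le> B"
  shows "\<exists>J. has_stieltjes_integral p v a b J"
proof -
  obtain \<Phi> where \<Phi>: "\<And>x. x \<in> {a..b} \<Longrightarrow> (\<Phi> has_real_derivative v x * p' x) (at x within {a..b})"
    using antiderivative_continuous[of a b "\<lambda>x. v x * p' x"] v p'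
    by (auto simp: has_real_derivative_iff_has_vector_derivative intro!: continuous_intros)
  have "compact (p' ` {a..b})" by (intro compact_continuous_image p') auto
  then have "bounded (p' ` {a..b})" by (rule compact_imp_bounded)
  then obtain C where "C > 0" "\<forall>y\<in>p' ` {a..b}. norm y \<le> C" by (auto simp only: bounded_pos)
  then have C: "C > 0" "\<And>x. x \<in> {a..b} \<Longrightarrow> \<bar>p' x\<bar> \<le> C" by auto
  have B0: "B \<ge> 0"
    using B[OF partition_points_uniform[OF ab, of 1]] by (auto intro: order.trans[OF sum_nonneg])
  \<comment> \<open>Integration by parts, \<Phi> being an antiderivative of v p'.\<close>
  define J where "J = p b * v b - p a * v a - (\<Phi> b - \<Phi> a)"
  have "has_stieltjes_integral p v a b J"
    unfolding has_stieltjes_integral_def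
  proof (intro allI impI)
    fix \<epsilon> :: real assume \<epsilon>: "\<epsilon> > 0"
    \<comment> \<open>Two errors are allowed \<epsilon> / 2 each: C e (b - a) from the Riemann sum
      of v p', and C \<delta> B from moving the tags. The B + 1 in \<delta> keeps the denominator
      positive and the second bound strict.\<close>
    define e where "e = \<epsilon> / (2 * C * (b - a))"
    have e: "e > 0" using \<epsilon> C ab by (simp add: e_def)
    have "uniformly_continuous_on {a..b} v"
      by (intro compact_uniformly_continuous v) auto
    then obtain d where "d > 0" "\<forall>y\<in>{a..b}. \<forall>x\<in>{a..b}. \<bar>x - y\<bar> < d \<longrightarrow> \<bar>v x - v y\<bar> < e"
      unfolding uniformly_continuous_on_def dist_real_def using e by blast
    then have d: "d > 0" "\<And>x y. x \<in> {a..b} \<Longrightarrow> y \<in> {a..b} \<Longrightarrow> \<bar>x - y\<bar> < d \<Longrightarrow> \<bar>v x - v y\<bar> < e"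
      by simp_all
    define \<delta> where "\<delta> = min d (\<epsilon> / (2 * C * (B + 1)))"
    have \<delta>: "\<delta> > 0" using d \<epsilon> C B0 by (simp add: \<delta>_def)
    have "\<bar>(\<Sum>k=1..n. p (s k) * (v (t k) - v (t (k - 1)))) - J\<bar> < \<epsilon>"
      if part: "partition_points a b n t" and mesh: "mesh n t < \<delta>" and s: "\<forall>k\<in>{1..n}. s k \<in> {t (k - 1)..t k}"
      for n t s
    proof -
      have mem: "t k \<in> {a..b}" if "k \<le> n" for k using partition_points_mem[OF part that] .
      have sub: "{t (k - 1)..t k} \<subseteq> {a..b}" if "k \<in> {1..n}" for k
        using mem[of k] mem[of "k - 1"] that by auto
      have len: "t k - t (k - 1) < \<delta>" if "k \<in> {1..n}" for k
        using diff_le_mesh[OF that, of t] mesh by linarith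
      \<comment> \<open>Tags are moved to right endpoints, where summation by parts is an exact
        identity.\<close>
      have tag: "\<bar>(\<Sum>k=1..n. (p (s k) - p (t k)) * (v (t k) - v (t (k - 1))))\<bar> \<le> C * \<delta> * B"
      proof -
        have "\<bar>(\<Sum>k=1..n. (p (s k) - p (t k)) * (v (t k) - v (t (k - 1))))\<bar>
            \<le> (\<Sum>k=1..n. C * \<delta> * \<bar>v (t k) - v (t (k - 1))\<bar>)"
        proof (intro order.trans[OF sum_abs] sum_mono)
          fix k assume k: "k \<in> {1..n}"
          have sk: "s k \<in> {t (k - 1)..t k}" using s k by blast
          have "norm (p (s k) - p (t k)) \<le> C * norm (s k - t k)"
          proof (rule field_differentiable_bound[where S = "{a..b}" and f' = p'])
            show "s k \<in> {a..b}" using sub[OF k] sk by blast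
            show "t k \<in> {a..b}" using k by (intro mem) simp
            show "norm (p' x) \<le> C" if "x \<in> {a..b}" for x using C(2)[OF that] by simp
          qed (auto intro: has_field_derivative_at_within p)
          also have "\<dots> \<le> C * \<delta>" using C sk len[OF k] by (intro mult_left_mono) auto
          finally show "\<bar>(p (s k) - p (t k)) * (v (t k) - v (t (k - 1)))\<bar> \<le> C * \<delta> * \<bar>v (t k) - v (t (k - 1))\<bar>"
            by (simp add: abs_mult mult_right_mono)
        qed
        also have "\<dots> = C * \<delta> * (\<Sum>k=1..n. \<bar>v (t k) - v (t (k - 1))\<bar>)" by (simp add: sum_distrib_left)
        also have "\<dots> \<le> C * \<delta> * B" using B[OF part] C \<delta> by (intro mult_left_mono) auto
        finally show ?thesis .
      qed
      \<comment> \<open>On one interval the function \<Phi> - v(left endpoint) p has derivative p'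
        (v - v(left endpoint)), which is at most C e in absolute value.\<close>
      have parts: "\<bar>\<Sum>k=1..n. (\<Phi> (t k) - \<Phi> (t (k - 1))) - v (t (k - 1)) * (p (t k) - p (t (k - 1)))\<bar> \<le> C * e * (b - a)"
      proof -
        have "\<bar>\<Sum>k=1..n. (\<Phi> (t k) - \<Phi> (t (k - 1))) - v (t (k - 1)) * (p (t k) - p (t (k - 1)))\<bar>
            \<le> (\<Sum>k=1..n. C * e * (t k - t (k - 1)))"
        proof (intro order.trans[OF sum_abs] sum_mono)
          fix k assume k: "k \<in> {1..n}"
          let ?g = "\<lambda>x. \<Phi> x - v (t (k - 1)) * p x"
          have lt: "t (k - 1) < t k" using partition_points_less[OF part k] .
          have "norm (?g (t k) - ?g (t (k - 1))) \<le> (C * e) * norm (t k - t (k - 1))"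
          proof (rule field_differentiable_bound[where S = "{t (k - 1)..t k}" and f' = "\<lambda>x. v x * p' x - v (t (k - 1)) * p' x"])
            fix x assume x: "x \<in> {t (k - 1)..t k}"
            then have xab: "x \<in> {a..b}" using sub[OF k] by blast
            show "(?g has_field_derivative v x * p' x - v (t (k - 1)) * p' x) (at x within {t (k - 1)..t k})"
              by (intro DERIV_diff DERIV_subset[OF \<Phi>[OF xab] sub[OF k]] DERIV_cmult has_field_derivative_at_within[OF p])
            have "\<bar>v x - v (t (k - 1))\<bar> < e"
              using x xab len[OF k] mem[of "k - 1"] k by (intro d) (auto simp: \<delta>_def)
            then have "\<bar>p' x\<bar> * \<bar>v x - v (t (k - 1))\<bar> \<le> C * e"
              using C xab by (intro mult_mono) auto
            moreover have "v x * p' x - v (t (k - 1)) * p' x = p' x * (v x - v (t (k - 1)))"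
              by (simp add: algebra_simps)
            ultimately show "norm (v x * p' x - v (t (k - 1)) * p' x) \<le> C * e"
              by (simp only: abs_mult real_norm_def)
          qed (use lt in auto)
          then show "\<bar>(\<Phi> (t k) - \<Phi> (t (k - 1))) - v (t (k - 1)) * (p (t k) - p (t (k - 1)))\<bar> \<le> C * e * (t k - t (k - 1))"
            using lt by (simp add: algebra_simps)
        qed
        also have "\<dots> = C * e * (\<Sum>k=1..n. t k - t (k - 1))" by (simp add: sum_distrib_left)
        also have "\<dots> = C * e * (b - a)"
          using part by (simp only: sum_telescope_pred) (simp add: partition_points_def)
        finally show ?thesis .
      qed
      have "(\<Sum>k=1..n. p (s k) * (v (t k) - v (t (k - 1)))) - J
        = (\<Sum>k=1..n. (p (s k) - p (t k)) * (v (t k) - v (t (k - 1))))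
          + (\<Sum>k=1..n. (\<Phi> (t k) - \<Phi> (t (k - 1))) - v (t (k - 1)) * (p (t k) - p (t (k - 1))))"
      proof -
        have "J = (\<Sum>k=1..n. (\<lambda>k. p (t k) * v (t k) - \<Phi> (t k)) k - (\<lambda>k. p (t k) * v (t k) - \<Phi> (t k)) (k - 1))"
          using part sum_telescope_pred[of "\<lambda>k. p (t k) * v (t k) - \<Phi> (t k)" n]
          by (simp only: J_def partition_points_def)
        \<comment> \<open>Termwise, p at the right end times the increment of v is the increment of
          p v minus v at the left end times the increment of p.\<close>
        moreover have "(\<Sum>k=1..n. p (s k) * (v (t k) - v (t (k - 1)))) =
          (\<Sum>k=1..n. ((p (s k) - p (t k)) * (v (t k) - v (t (k - 1)))
            + ((\<Phi> (t k) - \<Phi> (t (k - 1))) - v (t (k - 1)) * (p (t k) - p (t (k - 1)))))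
            + ((\<lambda>k. p (t k) * v (t k) - \<Phi> (t k)) k - (\<lambda>k. p (t k) * v (t k) - \<Phi> (t k)) (k - 1)))"
          by (intro sum.cong refl) (simp add: algebra_simps)
        ultimately show ?thesis unfolding sum.distrib by linarith
      qed
      also have "\<bar>\<dots>\<bar> \<le> C * \<delta> * B + C * e * (b - a)" using tag parts by linarith
      also have "C * e * (b - a) = \<epsilon> / 2"
      proof -
        have "C * (\<epsilon> / (2 * C * D)) * D = \<epsilon> / 2" if "D \<noteq> 0" for D using that C(1) by simp
        then show ?thesis unfolding e_def using ab by simp
      qed
      also have "C * \<delta> * B < \<epsilon> / 2"
      proof -
        have "C * \<delta> * B < C * \<delta> * (B + 1)" using C \<delta> by (intro mult_strict_left_mono) auto
        also have "\<dots> \<le> C * (\<epsilon> / (2 * C * (B + 1))) * (B + 1)"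
          using C B0 by (intro mult_right_mono mult_left_mono) (auto simp: \<delta>_def)
        also have "\<dots> = \<epsilon> / 2"
        proof -
          have "C * (\<epsilon> / (2 * C * D)) * D = \<epsilon> / 2" if "D \<noteq> 0" for D using that C(1) by simp
          then show ?thesis using B0 by simp
        qed
        finally show ?thesis .
      qed
      finally show ?thesis by simp
    qed
    then show "\<exists>\<delta>>0. \<forall>n t s. partition_points a b n t \<longrightarrow> mesh n t < \<delta> \<longrightarrow> (\<forall>k\<in>{1..n}. s k \<in> {t (k - 1)..t k}) \<longrightarrow>
        \<bar>(\<Sum>k=1..n. p (s k) * (v (t k) - v (t (k - 1)))) - J\<bar> < \<epsilon>"
      by (intro exI[of _ \<delta>] conjI \<delta> allI impI)
  qed
  then show ?thesis by blast
qed

text \<open>Polynomials are uniformly dense and are integrable by the C1 case; bounded variation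
  makes integrals and sums Lipschitz in the sup norm of the integrand, so the integrals of the
  approximants converge to the required value.\<close>

lemma stieltjes_integrable_continuous:
  fixes g v :: "real \<Rightarrow> real"
  assumes ab: "a < b" and g: "continuous_on {a..b} g" and v: "continuous_on {a..b} v"
    and bv: "bounded_variation a b v"
  shows "stieltjes_integrable g v a b"
proof -
  obtain B where B: "\<And>n t. partition_points a b n t \<Longrightarrow> (\<Sum>k=1..n. \<bar>v (t k) - v (t (k - 1))\<bar>) \<le> B"
    using bv unfolding bounded_variation_def by blast
  have B0: "B \<ge> 0"
    using B[OF partition_points_uniform[OF ab, of 1]] by (auto intro: order.trans[OF sum_nonneg])
  have "\<exists>p J. (\<forall>x\<in>{a..b}. \<bar>g x - p x\<bar> \<le> e) \<and> has_stieltjes_integral p v a b J" if e: "e > 0" for e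
  proof -
    obtain p where p: "real_polynomial_function p" "\<And>x. x \<in> {a..b} \<Longrightarrow> \<bar>g x - p x\<bar> < e"
      using Stone_Weierstrass_real_polynomial_function[OF compact_Icc g e] by blast
    obtain p' where p': "real_polynomial_function p'" "\<And>x. (p has_real_derivative p' x) (at x)"
      using has_real_derivative_polynomial_function[OF p(1)] by blast
    have "continuous_on {a..b} p'"
      using p'(1) by (intro continuous_on_polymonial_function) (simp add: real_polynomial_function_eq)
    then have "\<exists>J. has_stieltjes_integral p v a b J"
      using p'(2) by (intro has_stieltjes_integral_C1[OF ab v _ _ B])
    then show ?thesis using p(2) less_imp_le by blast
  qed
  then have "\<exists>p J. (\<forall>x\<in>{a..b}. \<bar>g x - p x\<bar> \<le> 1 / real (Suc i)) \<and> has_stieltjes_integral p v a b J" for i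
    by simp
  then obtain p J where p: "\<And>i x. x \<in> {a..b} \<Longrightarrow> \<bar>g x - p i x\<bar> \<le> 1 / real (Suc i)"
      and J: "\<And>i. has_stieltjes_integral (p i) v a b (J i)"
    by metis
  have lim0: "(\<lambda>i. 1 / real (Suc i) * B) \<longlonglongrightarrow> 0"
    using tendsto_mult_right[OF LIMSEQ_inverse_real_of_nat, of B] by (simp add: inverse_eq_divide)
  have Jdiff: "\<bar>J i - J k\<bar> \<le> 1 / real (Suc i) * B + 1 / real (Suc k) * B" for i k
  proof -
    have "\<bar>J i - J k\<bar> \<le> (1 / real (Suc i) + 1 / real (Suc k)) * B"
    proof (rule has_stieltjes_integral_diff_le[OF ab J J _ _ B])
      fix x assume "x \<in> {a..b}"
      from p[OF this, of i] p[OF this, of k] show "\<bar>p i x - p k x\<bar> \<le> 1 / real (Suc i) + 1 / real (Suc k)"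
        by linarith
    qed auto
    then show ?thesis by (simp only: distrib_right)
  qed
  have "Cauchy J"
  proof (rule metric_CauchyI)
    fix e :: real assume "e > 0"
    then obtain M where M: "\<forall>i\<ge>M. 1 / real (Suc i) * B < e / 2"
      using order_tendstoD(2)[OF lim0, of "e / 2"] by (auto simp: eventually_sequentially)
    have "dist (J i) (J k) < e" if "i \<ge> M" "k \<ge> M" for i k
      unfolding dist_real_def using Jdiff[of i k] M[rule_format, OF that(1)] M[rule_format, OF that(2)] by linarith
    then show "\<exists>M. \<forall>m\<ge>M. \<forall>n\<ge>M. dist (J m) (J n) < e" by blast
  qed
  then obtain L where L: "J \<longlonglongrightarrow> L" using Cauchy_convergent_iff convergent_def by blast
  have "has_stieltjes_integral g v a b L"
    unfolding has_stieltjes_integral_def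
  proof (intro allI impI)
    fix \<epsilon> :: real assume "\<epsilon> > 0"
    then have \<epsilon>: "\<epsilon> / 3 > 0" by simp
    have "\<forall>\<^sub>F i in sequentially. dist (J i) L < \<epsilon> / 3 \<and> 1 / real (Suc i) * B < \<epsilon> / 3"
      using tendstoD[OF L \<epsilon>] order_tendstoD(2)[OF lim0 \<epsilon>] by (rule eventually_conj)
    then obtain i where i: "\<bar>J i - L\<bar> < \<epsilon> / 3" "1 / real (Suc i) * B < \<epsilon> / 3"
      unfolding dist_real_def eventually_sequentially by blast
    obtain \<delta> where \<delta>: "\<delta> > 0" "\<And>n t s. partition_points a b n t \<Longrightarrow> mesh n t < \<delta> \<Longrightarrow> \<forall>k\<in>{1..n}. s k \<in> {t (k - 1)..t k} \<Longrightarrow>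
        \<bar>(\<Sum>k=1..n. p i (s k) * (v (t k) - v (t (k - 1)))) - J i\<bar> < \<epsilon> / 3"
      using J[of i] \<epsilon> unfolding has_stieltjes_integral_def by meson
    have "\<bar>(\<Sum>k=1..n. g (s k) * (v (t k) - v (t (k - 1)))) - L\<bar> < \<epsilon>"
      if nts: "partition_points a b n t" "mesh n t < \<delta>" "\<forall>k\<in>{1..n}. s k \<in> {t (k - 1)..t k}" for n t s
    proof -
      have "0 \<le> 1 / real (Suc i)" by simp
      note stieltjes_sum_diff_le[where p = g and q = "p i" and v = v, OF nts(1,3) p this B]
      moreover note \<delta>(2)[OF nts]
      ultimately show ?thesis using i by linarith
    qed
    then show "\<exists>\<delta>>0. \<forall>n t s. partition_points a b n t \<longrightarrow> mesh n t < \<delta> \<longrightarrow> (\<forall>k\<in>{1..n}. s k \<in> {t (k - 1)..t k}) \<longrightarrow>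
        \<bar>(\<Sum>k=1..n. g (s k) * (v (t k) - v (t (k - 1)))) - L\<bar> < \<epsilon>"
      by (intro exI[of _ \<delta>] conjI \<delta>(1) allI impI)
  qed
  then show ?thesis unfolding stieltjes_integrable_def by blast
qed

section \<open>The pathwise estimate\<close>

lemma continuous_on_compose_curried:
  fixes g :: "real \<Rightarrow> real \<Rightarrow> real"
  assumes "continuous_on UNIV (\<lambda>(x, v). g x v)" "continuous_on S a" "continuous_on S b"
  shows "continuous_on S (\<lambda>z. g (a z) (b z))"
  using continuous_on_compose2[OF assms(1) continuous_on_Pair[OF assms(2,3)]] by simp

lemma C_partial_1_1E:
  assumes "C_partial 1 1 f"
  obtains f1 f2 where
    "\<And>x v. ((\<lambda>y. f y v) has_real_derivative f1 x v) (at x)"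
    "\<And>x v. ((\<lambda>w. f x w) has_real_derivative f2 x v) (at v)"
    "continuous_on UNIV (\<lambda>(x, v). f x v)"
    "continuous_on UNIV (\<lambda>(x, v). f1 x v)"
    "continuous_on UNIV (\<lambda>(x, v). f2 x v)"
proof
  have *: "\<forall>i<1. \<forall>x v. (deriv ^^ i) (\<lambda>y. f y v) field_differentiable at x"
    "\<forall>i\<le>1. continuous_on UNIV (\<lambda>(x, v). (deriv ^^ i) (\<lambda>y. f y v) x)"
    "\<forall>i<1. \<forall>x v. (deriv ^^ i) (\<lambda>w. f x w) field_differentiable at v"
    "\<forall>i\<le>1. continuous_on UNIV (\<lambda>(x, v). (deriv ^^ i) (\<lambda>w. f x w) v)"
    using assms by (auto simp only: C_partial_def)
  show "((\<lambda>y. f y v) has_real_derivative deriv (\<lambda>y. f y v) x) (at x)" for x v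
    using *(1)[rule_format, of 0 v x] by (simp add: DERIV_deriv_iff_field_differentiable)
  show "((\<lambda>w. f x w) has_real_derivative deriv (\<lambda>w. f x w) v) (at v)" for x v
    using *(3)[rule_format, of 0 x v] by (simp add: DERIV_deriv_iff_field_differentiable)
  show "continuous_on UNIV (\<lambda>(x, v). f x v)" using *(2)[rule_format, of 0] by simp
  show "continuous_on UNIV (\<lambda>(x, v). deriv (\<lambda>y. f y v) x)" using *(2)[rule_format, of 1] by simp
  show "continuous_on UNIV (\<lambda>(x, v). deriv (\<lambda>w. f x w) v)" using *(4)[rule_format, of 1] by simp
qed

text \<open>The fundamental theorem is applied on [-R, R] with R = |x| + 1, which contains 0 and has
  \<open>x\<close> in its interior; this treats both signs of \<open>x\<close> at once and gives a
  two-sided derivative.\<close>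

lemma LBINT_has_real_derivative:
  fixes h :: "real \<Rightarrow> real"
  assumes "continuous_on UNIV h"
  shows "((\<lambda>x. LBINT y=0..x. h y) has_real_derivative h x) (at x)"
proof -
  define R where "R = \<bar>x\<bar> + 1"
  have "continuous_on {- R..R} h" by (rule continuous_on_subset[OF assms subset_UNIV])
  then have "((\<lambda>x. LBINT y=ereal 0..ereal x. h y) has_vector_derivative h x) (at x within {- R..R})"
    by (intro interval_integral_FTC2) (simp_all add: R_def abs_if)
  moreover have "at x within {- R..R} = at x"
    by (rule at_within_interior) (simp add: R_def abs_if)
  ultimately show ?thesis
    by (simp only: has_real_derivative_iff_has_vector_derivative zero_ereal_def)
qed

text \<open>After rescaling the integral to \<open>[0, 1]\<close>, Leibniz' rule and joint continuity need no case
  distinction on the sign of \<open>x\<close>.\<close>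

lemma primitive_eq_integral:
  fixes f :: "real \<Rightarrow> real \<Rightarrow> real" and x :: real
  assumes f: "continuous_on UNIV (\<lambda>(x, v). f x v)"
  shows "(LBINT y=0..x. f y v) = integral (cbox 0 1) (\<lambda>s. x * f (x * s) v)"
proof -
  define F where "F x = (LBINT y=0..x. f y v)" for x :: real
  have d: "(F has_real_derivative f y v) (at y)" for y
    unfolding F_def[abs_def]
    by (intro LBINT_has_real_derivative continuous_on_compose_curried[OF f] continuous_intros)
  have "((\<lambda>s. F (x * s)) has_real_derivative f (x * s) v * (x * 1)) (at s)" for s
    by (rule DERIV_chain2[OF d]) (intro DERIV_cmult DERIV_ident)
  then have v: "((\<lambda>s. F (x * s)) has_vector_derivative x * f (x * s) v) (at s within {0..1})" for s
    unfolding has_real_derivative_iff_has_vector_derivative mult_1_right mult.commute[of _ x]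
    by (rule has_vector_derivative_at_within)
  have "((\<lambda>s. x * f (x * s) v) has_integral F (x * 1) - F (x * 0)) {0..1}"
    by (rule fundamental_theorem_of_calculus[OF zero_le_one v])
  then have "integral {0..1} (\<lambda>s. x * f (x * s) v) = F (x * 1) - F (x * 0)"
    by (rule integral_unique)
  moreover have "F 0 = 0" unfolding F_def zero_ereal_def by (rule interval_integral_endpoints_same)
  ultimately have "F x = integral {0..1} (\<lambda>s. x * f (x * s) v)" by simp
  then show ?thesis by (simp add: F_def)
qed

lemma continuous_on_primitive:
  fixes f :: "real \<Rightarrow> real \<Rightarrow> real"
  assumes f: "continuous_on UNIV (\<lambda>(x, v). f x v)"
  shows "continuous_on UNIV (\<lambda>(x :: real, v). LBINT y=0..x. f y v)"
proof -
  have "continuous_on UNIV (\<lambda>z. integral (cbox 0 1) (\<lambda>s. fst z * f (fst z * s) (snd z)))"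
    by (intro integral_continuous_on_param)
      (unfold case_prod_beta, intro continuous_intros continuous_on_compose_curried[OF f])
  then show ?thesis by (simp only: primitive_eq_integral[OF f] case_prod_unfold)
qed

lemma primitive_has_derivative_snd:
  fixes f f2 :: "real \<Rightarrow> real \<Rightarrow> real" and x :: real
  assumes f: "continuous_on UNIV (\<lambda>(x, v). f x v)" and f2: "continuous_on UNIV (\<lambda>(x, v). f2 x v)"
    and deriv: "\<And>x v. ((\<lambda>w. f x w) has_real_derivative f2 x v) (at v)"
  shows "((\<lambda>w. LBINT y=0..x. f y w) has_real_derivative (LBINT y=0..x. f2 y v)) (at v)"
  unfolding primitive_eq_integral[OF f] primitive_eq_integral[OF f2]
proof (rule leibniz_rule_field_derivative[where U = UNIV])
  show "((\<lambda>w. x * f (x * s) w) has_real_derivative x * f2 (x * s) w) (at w)" for w s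
    by (intro DERIV_cmult deriv)
  show "(\<lambda>s. x * f (x * s) w) integrable_on cbox 0 1" for w
    by (intro integrable_continuous continuous_intros continuous_on_compose_curried[OF f])
  show "continuous_on (UNIV \<times> cbox 0 1) (\<lambda>(w, s). x * f2 (x * s) w)"
    unfolding case_prod_beta by (intro continuous_intros continuous_on_compose_curried[OF f2])
qed auto

section \<open>Local estimates for the symmetric sum\<close>

lemma uniformly_continuous_curried:
  fixes g :: "real \<Rightarrow> real \<Rightarrow> real"
  assumes "continuous_on UNIV (\<lambda>(x, v). g x v)" "e > 0"
  obtains d where "d > 0" "\<And>x x' v v'. \<lbrakk>x \<in> {-R..R}; x' \<in> {-R..R}; v \<in> {-R..R}; v' \<in> {-R..R};
    \<bar>x - x'\<bar> < d; \<bar>v - v'\<bar> < d\<rbrakk> \<Longrightarrow> \<bar>g x v - g x' v'\<bar> < e"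
proof -
  have uc: "uniformly_continuous_on ({-R..R} \<times> {-R..R}) (\<lambda>(x, v). g x v)"
    by (intro compact_uniformly_continuous compact_Times compact_Icc continuous_on_subset[OF assms(1)] subset_UNIV)
  obtain d where d: "d > 0" "\<forall>z\<in>{-R..R} \<times> {-R..R}. \<forall>z'\<in>{-R..R} \<times> {-R..R}.
      dist z' z < d \<longrightarrow> dist ((\<lambda>(x, v). g x v) z') ((\<lambda>(x, v). g x v) z) < e"
    using uc[unfolded uniformly_continuous_on_def, rule_format, OF assms(2)] by (elim exE conjE)
  show thesis
  proof
    \<comment> \<open>Halved because the product distance is estimated by the sum of the coordinate
      distances.\<close>
    show "d / 2 > 0" using d by simp
    fix x x' v v' assume *: "x \<in> {-R..R}" "x' \<in> {-R..R}" "v \<in> {-R..R}" "v' \<in> {-R..R}"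
      "\<bar>x - x'\<bar> < d / 2" "\<bar>v - v'\<bar> < d / 2"
    have "dist (x, v) (x', v') \<le> \<bar>x - x'\<bar> + \<bar>v - v'\<bar>"
      using sqrt_sum_squares_le_sum_abs[of "x - x'" "v - v'"] by (simp add: dist_Pair_Pair dist_real_def)
    also have "\<dots> < d" using *(5,6) by linarith
    finally have "dist ((\<lambda>(x, v). g x v) (x, v)) ((\<lambda>(x, v). g x v) (x', v')) < e"
      using *(1-4) d(2)[rule_format, of "(x', v')" "(x, v)"] by simp
    then show "\<bar>g x v - g x' v'\<bar> < e" by (simp add: dist_real_def)
  qed
qed

lemma abs_diff_le_closed_segment:
  fixes a b r s :: real
  assumes "s \<in> closed_segment a b" "r \<in> closed_segment a b"
  shows "\<bar>s - r\<bar> \<le> \<bar>b - a\<bar>"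
proof (cases "a \<le> b")
  case True
  then have "s \<in> {a..b}" "r \<in> {a..b}" using assms by (simp_all add: closed_segment_eq_real_ivl)
  then show ?thesis unfolding atLeastAtMost_iff by linarith
next
  case False
  then have "s \<in> {b..a}" "r \<in> {b..a}" using assms by (simp_all add: closed_segment_eq_real_ivl)
  then show ?thesis unfolding atLeastAtMost_iff by linarith
qed

text \<open>With only one derivative of \<open>h\<close> the classical cubic error is out of reach;
  the oscillation of \<open>h'\<close> gives a small multiple of the squared length instead.
  \<open>a\<close> and \<open>b\<close> are not ordered, since they will be values of a
  path.\<close>

lemma trapezoid_error:
  fixes h H h' :: "real \<Rightarrow> real"
  assumes H: "\<And>s. (H has_real_derivative h s) (at s)" and h: "\<And>s. (h has_real_derivative h' s) (at s)"
    and e: "\<And>s r. s \<in> closed_segment a b \<Longrightarrow> r \<in> closed_segment a b \<Longrightarrow> \<bar>h' r - h' s\<bar> \<le> e"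
  shows "\<bar>(h a + h b) / 2 * (b - a) - (H b - H a)\<bar> \<le> e * (b - a)\<^sup>2"
proof -
  \<comment> \<open>The error as a function of the right end. Its derivative is minus half the
    remainder of the linear expansion of \<open>h\<close> about \<open>s\<close>, taken at
    \<open>a\<close>, so two mean value estimates suffice.\<close>
  define P where "P s = (h a + h s) / 2 * (s - a) - (H s - H a)" for s
  have e0: "0 \<le> e" using e[of a a] by simp
  have "norm (P b - P a) \<le> (e * \<bar>b - a\<bar>) * norm (b - a)"
  proof (rule field_differentiable_bound[where S = "closed_segment a b"])
    fix s assume s: "s \<in> closed_segment a b"
    have seg: "closed_segment a s \<subseteq> closed_segment a b" "\<bar>s - a\<bar> \<le> \<bar>b - a\<bar>"
      using s by (auto simp: closed_segment_eq_real_ivl split: if_splits)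
    have "norm ((h s - h' s * s) - (h a - h' s * a)) \<le> e * norm (s - a)"
    proof (rule field_differentiable_bound[where S = "closed_segment a s" and f' = "\<lambda>r. h' r - h' s"])
      fix r assume r: "r \<in> closed_segment a s"
      have "((\<lambda>r. h r - h' s * r) has_real_derivative h' r - h' s * 1) (at r)"
        by (intro DERIV_diff h DERIV_cmult DERIV_ident)
      then show "((\<lambda>r. h r - h' s * r) has_real_derivative h' r - h' s) (at r within closed_segment a s)"
        by (simp add: has_field_derivative_at_within)
      show "norm (h' r - h' s) \<le> e" using e[OF s subsetD[OF seg(1) r]] by simp
    qed auto
    also have "\<dots> \<le> e * \<bar>b - a\<bar>" using seg e0 by (intro mult_left_mono) auto
    finally have *: "\<bar>h s - h a - h' s * (s - a)\<bar> \<le> e * \<bar>b - a\<bar>" by (simp add: algebra_simps)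
    have "(P has_real_derivative ((0 + h' s) / 2 * (s - a) + (1 - 0) * ((h a + h s) / 2)) - (h s - 0)) (at s)"
      unfolding P_def[abs_def]
      by (intro DERIV_diff DERIV_mult DERIV_cdivide DERIV_add DERIV_const DERIV_ident h H)
    moreover have "((0 + h' s) / 2 * (s - a) + (1 - 0) * ((h a + h s) / 2)) - (h s - 0)
        = - (h s - h a - h' s * (s - a)) / 2" by (simp add: field_simps)
    ultimately show "(P has_real_derivative - (h s - h a - h' s * (s - a)) / 2) (at s within closed_segment a b)"
      by (simp only: has_field_derivative_at_within)
    show "norm (- (h s - h a - h' s * (s - a)) / 2) \<le> e * \<bar>b - a\<bar>" using * by simp
  qed auto
  then show ?thesis by (simp add: P_def power2_eq_square mult.assoc)
qed

text \<open>The sum of squares stays on the right because the path \<open>x\<close> may have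
  infinite variation; every other error is proportional to an increment of \<open>v\<close> and sums
  to a bounded quantity. \<rho> depends on the path, \<delta> does not.\<close>

lemma symmetric_sum_estimate:
  fixes f f1 f2 F G :: "real \<Rightarrow> real \<Rightarrow> real" and x v :: "real \<Rightarrow> real"
  assumes f1: "\<And>x v. ((\<lambda>y. f y v) has_real_derivative f1 x v) (at x)"
    and f2: "\<And>x v. ((\<lambda>w. f x w) has_real_derivative f2 x v) (at v)"
    and F: "\<And>x v. ((\<lambda>y. F y v) has_real_derivative f x v) (at x)"
    and G: "\<And>x v. ((\<lambda>w. F x w) has_real_derivative G x v) (at v)"
    and cont: "continuous_on UNIV (\<lambda>(x, v). f1 x v)" "continuous_on UNIV (\<lambda>(x, v). f2 x v)"
      "continuous_on UNIV (\<lambda>(x, v). G x v)"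
    and x: "continuous_on {0..T} x" and v: "continuous_on {0..T} v" and bv: "bounded_variation 0 T v"
    and J: "has_stieltjes_integral (\<lambda>t. G (x t) (v t)) v 0 T J"
    and T: "T > 0" and \<delta>: "\<delta> > 0"
  shows "\<exists>\<rho>>0. \<forall>n t. partition_points 0 T n t \<longrightarrow> mesh n t < \<rho> \<longrightarrow>
    \<bar>(\<Sum>k=1..n. (f (x (t (k - 1))) (v (t (k - 1))) + f (x (t k)) (v (t k))) / 2 * (x (t k) - x (t (k - 1))))
      - (F (x T) (v T) - F (x 0) (v 0) - J)\<bar> \<le> \<delta> * (1 + (\<Sum>k=1..n. (x (t k) - x (t (k - 1)))\<^sup>2))"
proof -
  obtain B where B: "\<And>n t. partition_points 0 T n t \<Longrightarrow> (\<Sum>k=1..n. \<bar>v (t k) - v (t (k - 1))\<bar>) \<le> B"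
    using bv unfolding bounded_variation_def by blast
  have B0: "B \<ge> 0"
    using B[OF partition_points_uniform[OF T, of 1]] by (auto intro: order.trans[OF sum_nonneg])
  have "bounded (x ` {0..T} \<union> v ` {0..T})"
    by (intro compact_imp_bounded compact_Un compact_continuous_image x v) auto
  then obtain R where "\<forall>y\<in>x ` {0..T} \<union> v ` {0..T}. norm y \<le> R" by (auto simp only: bounded_iff)
  then have xv: "\<bar>x s\<bar> \<le> R" "\<bar>v s\<bar> \<le> R" if "s \<in> {0..T}" for s
    unfolding real_norm_def by (rule bspec, use that in blast)+
  have R: "x s \<in> {-R..R}" "v s \<in> {-R..R}" if "s \<in> {0..T}" for s
    using xv[OF that] unfolding atLeastAtMost_iff abs_le_iff by linarith+
  have "bounded ((\<lambda>(x, v). f2 x v) ` ({-R..R} \<times> {-R..R}))"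
    by (intro compact_imp_bounded compact_continuous_image compact_Times continuous_on_subset[OF cont(2)]) auto
  then obtain L where "L > 0" "\<forall>y\<in>(\<lambda>(x, v). f2 x v) ` ({-R..R} \<times> {-R..R}). norm y \<le> L"
    by (auto simp only: bounded_pos)
  then have L: "L > 0" "\<And>y w. y \<in> {-R..R} \<Longrightarrow> w \<in> {-R..R} \<Longrightarrow> \<bar>f2 y w\<bar> \<le> L" by auto
  \<comment> \<open>Makes the errors proportional to increments of \<open>v\<close> total at most
    \<delta> / 2; the other half is left for the Stieltjes sum.\<close>
  define e where "e = \<delta> / (2 * ((L + 1) * (B + 1)))"
  have e: "e > 0" using \<delta> L B0 by (simp add: e_def)
  obtain d1 where d1: "d1 > 0" "\<And>x x' v v'. \<lbrakk>x \<in> {-R..R}; x' \<in> {-R..R}; v \<in> {-R..R}; v' \<in> {-R..R};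
    \<bar>x - x'\<bar> < d1; \<bar>v - v'\<bar> < d1\<rbrakk> \<Longrightarrow> \<bar>f1 x v - f1 x' v'\<bar> < \<delta>"
    by (rule uniformly_continuous_curried[where R = R, OF cont(1) \<delta>]) (rule that)
  obtain d2 where d2: "d2 > 0" "\<And>x x' v v'. \<lbrakk>x \<in> {-R..R}; x' \<in> {-R..R}; v \<in> {-R..R}; v' \<in> {-R..R};
    \<bar>x - x'\<bar> < d2; \<bar>v - v'\<bar> < d2\<rbrakk> \<Longrightarrow> \<bar>G x v - G x' v'\<bar> < e"
    by (rule uniformly_continuous_curried[where R = R, OF cont(3) e]) (rule that)
  \<comment> \<open>\<open>d\<close> is at most \<open>e\<close> so that in the mixed term the
    increment of \<open>x\<close> itself provides the small factor.\<close>
  define d where "d = min e (min d1 d2)"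
  have d: "d > 0" using e d1 d2 by (simp add: d_def)
  have step: "\<bar>(f a u + f b w) / 2 * (b - a) - (F b w - F a u) + G b w * (w - u)\<bar>
      \<le> \<delta> * (b - a)\<^sup>2 + e * (L + 1) * \<bar>w - u\<bar>"
    if K: "a \<in> {-R..R}" "b \<in> {-R..R}" "u \<in> {-R..R}" "w \<in> {-R..R}" and near: "\<bar>b - a\<bar> < d" "\<bar>w - u\<bar> < d"
    for a b u w
  proof -
    have sub: "closed_segment a b \<subseteq> {-R..R}" "closed_segment u w \<subseteq> {-R..R}"
      using K by (intro closed_segment_subset convex_real_interval; simp)+
    have seg: "s \<in> {-R..R}" "\<bar>s - r\<bar> < d" if "s \<in> closed_segment a b" "r \<in> closed_segment a b" for s r
      using that sub near abs_diff_le_closed_segment[OF that] by auto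
    have seg': "s \<in> {-R..R}" "\<bar>s - w\<bar> < d" if "s \<in> closed_segment u w" for s
      using that sub near abs_diff_le_closed_segment[OF that ends_in_segment(2)] by auto
    have 1: "\<bar>(f a u + f b u) / 2 * (b - a) - (F b u - F a u)\<bar> \<le> \<delta> * (b - a)\<^sup>2"
    proof (rule trapezoid_error[where h' = "\<lambda>s. f1 s u"])
      fix s r assume "s \<in> closed_segment a b" "r \<in> closed_segment a b"
      then have "\<bar>f1 r u - f1 s u\<bar> < \<delta>"
        using seg[of r s] seg[of s r] K d1(1) by (intro d1(2)) (auto simp: d_def)
      then show "\<bar>f1 r u - f1 s u\<bar> \<le> \<delta>" by simp
    qed (rule F f1)+
    have 2: "\<bar>(f b w - f b u) / 2 * (b - a)\<bar> \<le> e * L * \<bar>w - u\<bar>"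
    proof -
      have "norm (f b w - f b u) \<le> L * norm (w - u)"
      proof (rule field_differentiable_bound[where S = "closed_segment u w" and f' = "f2 b"])
        show "((\<lambda>w. f b w) has_real_derivative f2 b s) (at s within closed_segment u w)" for s
          by (rule has_field_derivative_at_within[OF f2])
        show "norm (f2 b s) \<le> L" if "s \<in> closed_segment u w" for s
          using L(2)[OF K(2) seg'(1)[OF that]] by simp
      qed auto
      then have lip: "\<bar>f b w - f b u\<bar> \<le> L * \<bar>w - u\<bar>" by (simp only: real_norm_def)
      have "\<bar>b - a\<bar> \<le> e" using near(1) unfolding d_def by linarith
      with lip have "\<bar>f b w - f b u\<bar> * \<bar>b - a\<bar> \<le> (L * \<bar>w - u\<bar>) * e"
        by (rule mult_mono) (use L(1) in simp_all)
      moreover have "\<bar>(f b w - f b u) / 2 * (b - a)\<bar> = \<bar>f b w - f b u\<bar> * \<bar>b - a\<bar> / 2"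
        by (simp add: abs_mult)
      moreover have "0 \<le> \<bar>f b w - f b u\<bar> * \<bar>b - a\<bar>" by simp
      moreover have "(L * \<bar>w - u\<bar>) * e = e * L * \<bar>w - u\<bar>" by simp
      ultimately show ?thesis by linarith
    qed
    have 3: "\<bar>(F b w - F b u) - G b w * (w - u)\<bar> \<le> e * \<bar>w - u\<bar>"
    proof -
      have "norm ((F b w - G b w * w) - (F b u - G b w * u)) \<le> e * norm (w - u)"
      proof (rule field_differentiable_bound[where S = "closed_segment u w" and f' = "\<lambda>s. G b s - G b w"])
        fix s assume s: "s \<in> closed_segment u w"
        have "((\<lambda>s. F b s - G b w * s) has_real_derivative G b s - G b w * 1) (at s)"
          by (intro DERIV_diff G DERIV_cmult DERIV_ident)
        then show "((\<lambda>s. F b s - G b w * s) has_real_derivative G b s - G b w) (at s within closed_segment u w)"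
          by (simp add: has_field_derivative_at_within)
        have "\<bar>G b s - G b w\<bar> < e"
          using seg'[OF s] K d2(1) by (intro d2(2)) (auto simp: d_def)
        then show "norm (G b s - G b w) \<le> e" by simp
      qed auto
      then show ?thesis by (simp add: algebra_simps)
    qed
    \<comment> \<open>Trapezoid error with the second variable frozen at \<open>u\<close>, plus the
      cost of replacing \<open>u\<close> by \<open>w\<close> in \<open>f\<close>, minus the
      linearisation error of \<open>F\<close> in the second variable at \<open>b\<close>.\<close>
    have "(f a u + f b w) / 2 * (b - a) - (F b w - F a u) + G b w * (w - u)
      = ((f a u + f b u) / 2 * (b - a) - (F b u - F a u)) + (f b w - f b u) / 2 * (b - a)
        - ((F b w - F b u) - G b w * (w - u))" by (simp add: field_simps)
    moreover have "e * (L + 1) * \<bar>w - u\<bar> = e * L * \<bar>w - u\<bar> + e * \<bar>w - u\<bar>" by (simp add: algebra_simps)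
    ultimately show ?thesis using 1 2 3 by linarith
  qed
  have "uniformly_continuous_on {0..T} x" "uniformly_continuous_on {0..T} v"
    by (intro compact_uniformly_continuous x v; simp)+
  note uc = this[unfolded uniformly_continuous_on_def dist_real_def, rule_format, OF d]
  obtain r1 where r1: "r1 > 0" "\<forall>s\<in>{0..T}. \<forall>s'\<in>{0..T}. \<bar>s' - s\<bar> < r1 \<longrightarrow> \<bar>x s' - x s\<bar> < d"
    using uc(1) by (elim exE conjE)
  obtain r2 where r2: "r2 > 0" "\<forall>s\<in>{0..T}. \<forall>s'\<in>{0..T}. \<bar>s' - s\<bar> < r2 \<longrightarrow> \<bar>v s' - v s\<bar> < d"
    using uc(2) by (elim exE conjE)
  have "\<delta> / 2 > 0" using \<delta> by simp
  then obtain r3 where r3: "r3 > 0" "\<And>n t s. partition_points 0 T n t \<Longrightarrow> mesh n t < r3 \<Longrightarrow> \<forall>k\<in>{1..n}. s k \<in> {t (k - 1)..t k} \<Longrightarrow>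
        \<bar>(\<Sum>k=1..n. G (x (s k)) (v (s k)) * (v (t k) - v (t (k - 1)))) - J\<bar> < \<delta> / 2"
    using J unfolding has_stieltjes_integral_def by meson
  define \<rho> where "\<rho> = min r1 (min r2 r3)"
  have \<rho>: "\<rho> > 0" using r1 r2 r3 by (simp add: \<rho>_def)
  have est: "\<bar>(\<Sum>k=1..n. (f (x (t (k - 1))) (v (t (k - 1))) + f (x (t k)) (v (t k))) / 2 * (x (t k) - x (t (k - 1))))
      - (F (x T) (v T) - F (x 0) (v 0) - J)\<bar> \<le> \<delta> * (1 + (\<Sum>k=1..n. (x (t k) - x (t (k - 1)))\<^sup>2))"
    if part: "partition_points 0 T n t" and mesh: "mesh n t < \<rho>" for n t
  proof -
    let ?S = "\<lambda>k. (f (x (t (k - 1))) (v (t (k - 1))) + f (x (t k)) (v (t k))) / 2 * (x (t k) - x (t (k - 1)))"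
    let ?F = "\<lambda>k. F (x (t k)) (v (t k))"
    let ?G = "\<lambda>k. G (x (t k)) (v (t k)) * (v (t k) - v (t (k - 1)))"
    have lt: "t (k - 1) < t k" if "k \<in> {1..n}" for k using partition_points_less[OF part that] .
    have "\<bar>\<Sum>k=1..n. ?S k - (?F k - ?F (k - 1)) + ?G k\<bar>
        \<le> (\<Sum>k=1..n. \<delta> * (x (t k) - x (t (k - 1)))\<^sup>2 + e * (L + 1) * \<bar>v (t k) - v (t (k - 1))\<bar>)"
    proof (intro order.trans[OF sum_abs] sum_mono)
      fix k assume k: "k \<in> {1..n}"
      have mem: "t (k - 1) \<in> {0..T}" "t k \<in> {0..T}"
        using k by (auto intro!: partition_points_mem[OF part] simp del: atLeastAtMost_iff simp: atLeastAtMost_iff[where 'a = nat])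
      have "\<bar>t k - t (k - 1)\<bar> < \<rho>" using lt[OF k] diff_le_mesh[OF k, of t] mesh by linarith
      then have "\<bar>x (t k) - x (t (k - 1))\<bar> < d" "\<bar>v (t k) - v (t (k - 1))\<bar> < d"
        using r1(2) r2(2) mem by (auto simp: \<rho>_def)
      then show "\<bar>?S k - (?F k - ?F (k - 1)) + ?G k\<bar>
         \<le> \<delta> * (x (t k) - x (t (k - 1)))\<^sup>2 + e * (L + 1) * \<bar>v (t k) - v (t (k - 1))\<bar>"
        by (intro step R mem)
    qed
    also have "\<dots> = \<delta> * (\<Sum>k=1..n. (x (t k) - x (t (k - 1)))\<^sup>2) + e * (L + 1) * (\<Sum>k=1..n. \<bar>v (t k) - v (t (k - 1))\<bar>)"
      by (simp add: sum.distrib sum_distrib_left)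
    also have "e * (L + 1) * (\<Sum>k=1..n. \<bar>v (t k) - v (t (k - 1))\<bar>) \<le> e * (L + 1) * (B + 1)"
      using B[OF part] e L by (intro mult_left_mono) auto
    also have "e * (L + 1) * (B + 1) = \<delta> / 2"
    proof -
      have "\<delta> / (2 * D) * D = \<delta> / 2" if "D \<noteq> 0" for D using that by simp
      moreover have "(L + 1) * (B + 1) \<noteq> 0" using L(1) B0 by simp
      ultimately show ?thesis unfolding e_def mult.assoc by blast
    qed
    finally have main: "\<bar>\<Sum>k=1..n. ?S k - (?F k - ?F (k - 1)) + ?G k\<bar>
      \<le> \<delta> * (\<Sum>k=1..n. (x (t k) - x (t (k - 1)))\<^sup>2) + \<delta> / 2" by simp
    have tel: "(\<Sum>k=1..n. ?F k - ?F (k - 1)) = F (x T) (v T) - F (x 0) (v 0)"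
      using sum_telescope_pred[of ?F n] part by (simp only: partition_points_def)
    have "(\<Sum>k=1..n. ?S k - (?F k - ?F (k - 1)) + ?G k) = (\<Sum>k=1..n. ?S k) - (\<Sum>k=1..n. ?F k - ?F (k - 1)) + (\<Sum>k=1..n. ?G k)"
      by (simp only: sum.distrib sum_subtractf)
    moreover have "\<bar>(\<Sum>k=1..n. ?G k) - J\<bar> < \<delta> / 2"
      using r3(2)[OF part, of t] mesh lt by (auto simp: \<rho>_def less_imp_le)
    moreover have "\<delta> * (1 + (\<Sum>k=1..n. (x (t k) - x (t (k - 1)))\<^sup>2)) = \<delta> * (\<Sum>k=1..n. (x (t k) - x (t (k - 1)))\<^sup>2) + \<delta>"
      by (simp add: distrib_left)
    ultimately show ?thesis using main tel by linarith
  qed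
  show ?thesis by (intro exI[of _ \<rho>] conjI \<rho> allI impI est)
qed

section \<open>Increments along partitions\<close>

lemma uniformly_small_increments:
  fixes x :: "real \<Rightarrow> real"
  assumes "continuous_on {0..T} x" "\<And>n. partition_points 0 T (j n) (t n)"
    "(\<lambda>n. mesh (j n) (t n)) \<longlonglongrightarrow> 0" "\<delta> > 0"
  shows "\<forall>\<^sub>F n in sequentially. \<forall>k\<in>{1..j n}. \<bar>x (t n k) - x (t n (k - 1))\<bar> < \<delta>"
proof -
  have uc: "uniformly_continuous_on {0..T} x" by (intro compact_uniformly_continuous assms(1) compact_Icc)
  obtain r where r: "r > 0" "\<forall>s\<in>{0..T}. \<forall>s'\<in>{0..T}. \<bar>s' - s\<bar> < r \<longrightarrow> \<bar>x s' - x s\<bar> < \<delta>"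
    using uc[unfolded uniformly_continuous_on_def dist_real_def, rule_format, OF assms(4)] by (elim exE conjE)
  have "\<forall>\<^sub>F n in sequentially. mesh (j n) (t n) < r" by (rule order_tendstoD(2)[OF assms(3) r(1)])
  then show ?thesis
  proof eventually_elim
    case (elim n)
    show ?case
    proof
      fix k assume k: "k \<in> {1..j n}"
      have "k \<le> j n" "k - 1 \<le> j n" using k by auto
      note mem = this[THEN partition_points_mem[OF assms(2)]]
      have "\<bar>t n k - t n (k - 1)\<bar> < r"
        using partition_points_less[OF assms(2) k] diff_le_mesh[OF k, of "t n"] elim by linarith
      then show "\<bar>x (t n k) - x (t n (k - 1))\<bar> < \<delta>" using r(2) mem by blast
    qed
  qed
qed

lemma disjoint_partition_intervals:
  assumes "partition_points a b n t"
  shows "disjoint_family_on (\<lambda>k. {t (k - 1)<..t k}) {1..n}"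
proof -
  have "{t (k - 1)<..t k} \<inter> {t (l - 1)<..t l} = {}" if "k < l" "l \<le> n" for k l
  proof -
    have "k \<le> l - 1" "l - 1 \<le> n" using that by auto
    then have "t k \<le> t (l - 1)" by (rule partition_points_mono[OF assms])
    then show ?thesis by auto
  qed
  then show ?thesis
    unfolding disjoint_family_on_def by (metis Int_commute atLeastAtMost_iff linorder_neqE_nat)
qed

text \<open>An interval of one partition contained in no interval of another one contains one of its points.\<close>

lemma card_straddling_intervals:
  assumes s: "partition_points a b n s" and t: "partition_points a b m t"
  shows "card {k \<in> {1..m}. \<not> (\<exists>l\<in>{1..n}. {t (k - 1)<..t k} \<subseteq> {s (l - 1)<..s l})} \<le> Suc n"
proof -
  let ?A = "{k \<in> {1..m}. \<not> (\<exists>l\<in>{1..n}. {t (k - 1)<..t k} \<subseteq> {s (l - 1)<..s l})}"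
  have "\<exists>l. l \<le> n \<and> s l \<in> {t (k - 1)<..t k}" if k: "k \<in> ?A" for k
  proof -
    have k1: "k \<in> {1..m}" using k by blast
    have lt: "t (k - 1) < t k" by (rule partition_points_less[OF t k1])
    have mem: "a \<le> t (k - 1)" "t k \<le> b"
      using partition_points_mem[OF t, of "k - 1"] partition_points_mem[OF t, of k] k1 by auto
    \<comment> \<open>The first point of \<open>s\<close> not before \<open>t k\<close>. Its
      predecessor lies before \<open>t k\<close>, and after \<open>t (k - 1)\<close>, as otherwise
      the interval would fit between the two.\<close>
    define l where "l = (LEAST l. t k \<le> s l)"
    have ex: "t k \<le> s n" using mem s by (simp add: partition_points_def)
    have l: "t k \<le> s l" "l \<le> n" 
      unfolding l_def by (rule LeastI[where P = "\<lambda>l. t k \<le> s l", OF ex])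
        (rule Least_le[where P = "\<lambda>l. t k \<le> s l", OF ex])
    have "s 0 = a" using s by (simp add: partition_points_def)
    then have "l \<noteq> 0" using l(1) lt mem(1) by (intro notI) simp
    then have l1: "l \<in> {1..n}" using l by auto
    have "\<not> t k \<le> s (l - 1)" unfolding l_def by (rule not_less_Least) (use \<open>l \<noteq> 0\<close> in \<open>simp add: l_def\<close>)
    moreover have "\<not> s (l - 1) \<le> t (k - 1)"
    proof
      assume "s (l - 1) \<le> t (k - 1)"
      then have "{t (k - 1)<..t k} \<subseteq> {s (l - 1)<..s l}" using l(1) by auto
      then show False using k l1 by blast
    qed
    ultimately show ?thesis using l by (intro exI[of _ "l - 1"]) auto
  qed
  then have "\<forall>k\<in>?A. \<exists>l. l \<le> n \<and> s l \<in> {t (k - 1)<..t k}" by blast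
  from bchoice[OF this] obtain g where g: "\<And>k. k \<in> ?A \<Longrightarrow> g k \<le> n" "\<And>k. k \<in> ?A \<Longrightarrow> s (g k) \<in> {t (k - 1)<..t k}"
    by blast
  \<comment> \<open>Disjoint intervals contain distinct points, and \<open>s\<close> has n + 1 of
    them; the bound does not involve \<open>m\<close>.\<close>
  have "inj_on g ?A"
  proof (rule inj_onI, rule ccontr)
    fix k l assume *: "k \<in> ?A" "l \<in> ?A" "g k = g l" "k \<noteq> l"
    then have "{t (k - 1)<..t k} \<inter> {t (l - 1)<..t l} = {}"
      using disjoint_partition_intervals[OF t] unfolding disjoint_family_on_def by blast
    then show False using g(2)[OF *(1)] g(2)[OF *(2)] *(3) by auto
  qed
  then have "card ?A \<le> card {..n}"
    by (rule card_inj_on_le) (use g(1) in auto)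
  then show ?thesis by simp
qed

text \<open>The intervals (t (k - 1), t k] form \<open>refining_cells\<close>: finite additivity
  identifies increments of \<open>m\<close> with values of \<mu>, and path continuity makes the
  largest increment small.\<close>

lemma (in prob_space) increments_bounded_in_prob:
  fixes m :: "real \<Rightarrow> 'a \<Rightarrow> real"
  assumes \<mu>: "stochastic_measure M (restrict_space borel {0..T}) \<mu>"
    and m: "\<And>t. t \<in> {0..T} \<Longrightarrow> AE \<omega> in M. m t \<omega> = \<mu> {0<..t} \<omega>"
    and meas: "\<And>t. t \<in> {0..T} \<Longrightarrow> m t \<in> borel_measurable M"
    and cont: "AE \<omega> in M. continuous_on {0..T} (\<lambda>t. m t \<omega>)"
    and part: "\<And>n. partition_points 0 T (j n) (t n)" and mesh: "(\<lambda>n. mesh (j n) (t n)) \<longlonglongrightarrow> 0"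
    and \<epsilon>: "\<epsilon> > 0"
  shows "\<exists>C n0. \<forall>n\<ge>n0. prob {\<omega> \<in> space M. (\<Sum>k=1..j n. (m (t n k) \<omega> - m (t n (k - 1)) \<omega>)\<^sup>2) > C} \<le> \<epsilon>"
proof -
  let ?N = "restrict_space borel {0..T}"
  define I where "I n k = {t n (k - 1)<..t n k}" for n k
  have mem: "t n k \<in> {0..T}" "t n (k - 1) \<in> {0..T}" if "k \<in> {1..j n}" for n k
    using that partition_points_mem[OF part[of n], of k] partition_points_mem[OF part[of n], of "k - 1"] by auto
  have sets_Ioc: "{a<..b} \<in> sets ?N" if "a \<in> {0..T}" "b \<in> {0..T}" for a b
    using that by (subst sets_restrict_space_iff) auto
  have sets_I: "I n k \<in> sets ?N" if "k \<in> {1..j n}" for n k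
    unfolding I_def by (intro sets_Ioc mem that)
  have mu_meas: "A \<in> sets ?N \<Longrightarrow> \<mu> A \<in> borel_measurable M" for A
    using \<mu> by (simp add: stochastic_measure_def)
  have "AE \<omega> in M. \<mu> (I n k) \<omega> = m (t n k) \<omega> - m (t n (k - 1)) \<omega>" if k: "k \<in> {1..j n}" for n k
  proof -
    have lt: "t n (k - 1) < t n k" by (rule partition_points_less[OF part k])
    have eq: "{0<..t n (k - 1)} \<union> I n k = {0<..t n k}" "{0<..t n (k - 1)} \<inter> I n k = {}"
      using lt mem[OF k] by (auto simp: I_def)
    have "AE \<omega> in M. \<mu> ({0<..t n (k - 1)} \<union> I n k) \<omega> = \<mu> {0<..t n (k - 1)} \<omega> + \<mu> (I n k) \<omega>"
      by (rule stochastic_measure_Un[OF \<mu> _ sets_I[OF k] eq(2)]) (use mem[OF k] in \<open>auto intro!: sets_Ioc\<close>)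
    with m[OF mem(1)[OF k]] m[OF mem(2)[OF k]] show ?thesis
      unfolding eq(1) by eventually_elim simp
  qed
  \<comment> \<open>Only countably many intervals occur, so one null set serves for all of
    them.\<close>
  then have incr: "AE \<omega> in M. \<forall>n. \<forall>k\<in>{1..j n}. \<mu> (I n k) \<omega> = m (t n k) \<omega> - m (t n (k - 1)) \<omega>"
    by (simp add: AE_all_countable AE_ball_countable)
  interpret refining_cells M ?N \<mu> "\<lambda>n. {1..j n}" I "\<lambda>n. Suc (j n)"
  proof
    show "stochastic_measure M ?N \<mu>" by (rule \<mu>)
    show "space ?N \<in> sets ?N" by (rule sets.top)
    show "I n k \<in> sets ?N" if "k \<in> {1..j n}" for n k by (rule sets_I[OF that])
    show "I n k \<noteq> {}" if "k \<in> {1..j n}" for n k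
      using partition_points_less[OF part that] by (auto simp: I_def)
    show "disjoint_family_on (I n) {1..j n}" for n
      using disjoint_partition_intervals[OF part[of n]] by (simp add: I_def[abs_def])
    show "card {k \<in> {1..j m}. \<not> (\<exists>l\<in>{1..j n}. I m k \<subseteq> I n l)} \<le> Suc (j n)" for n m
      unfolding I_def by (rule card_straddling_intervals[OF part part])
    show "(\<lambda>n. prob {\<omega> \<in> space M. \<exists>k\<in>{1..j n}. \<delta> < \<bar>\<mu> (I n k) \<omega>\<bar>}) \<longlonglongrightarrow> 0" if \<delta>: "\<delta> > 0" for \<delta>
    proof (rule prob_tendsto_0_AE)
      have [measurable]: "\<mu> (I n k) \<in> borel_measurable M" if "k \<in> {1..j n}" for n k
        by (intro mu_meas sets_I that)
      show "Measurable.pred M (\<lambda>\<omega>. \<exists>k\<in>{1..j n}. \<delta> < \<bar>\<mu> (I n k) \<omega>\<bar>)" for n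
        by (intro pred_intros_finite) (simp, measurable)
      show "AE \<omega> in M. \<forall>\<^sub>F n in sequentially. \<not> (\<exists>k\<in>{1..j n}. \<delta> < \<bar>\<mu> (I n k) \<omega>\<bar>)"
        using incr cont
      proof eventually_elim
        case (elim \<omega>)
        from uniformly_small_increments[OF elim(2) part mesh \<delta>] show ?case
          by eventually_elim (use elim(1) in \<open>auto simp: not_less intro: less_imp_le\<close>)
      qed
    qed
  qed auto
  obtain C n0 where C: "\<forall>n\<ge>n0. prob {\<omega> \<in> space M. (\<Sum>k=1..j n. (\<mu> (I n k) \<omega>)\<^sup>2) > C} \<le> \<epsilon>"
    using quadratic_sums_bounded[OF \<epsilon>] by blast
  have "prob {\<omega> \<in> space M. (\<Sum>k=1..j n. (m (t n k) \<omega> - m (t n (k - 1)) \<omega>)\<^sup>2) > C}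
      = prob {\<omega> \<in> space M. (\<Sum>k=1..j n. (\<mu> (I n k) \<omega>)\<^sup>2) > C}" for n
  proof (rule measure_eq_AE)
    show "AE \<omega> in M. (\<omega> \<in> {\<omega> \<in> space M. (\<Sum>k=1..j n. (m (t n k) \<omega> - m (t n (k - 1)) \<omega>)\<^sup>2) > C})
      = (\<omega> \<in> {\<omega> \<in> space M. (\<Sum>k=1..j n. (\<mu> (I n k) \<omega>)\<^sup>2) > C})"
      using incr
    proof eventually_elim
      case (elim \<omega>)
      then have "(\<Sum>k=1..j n. (m (t n k) \<omega> - m (t n (k - 1)) \<omega>)\<^sup>2) = (\<Sum>k=1..j n. (\<mu> (I n k) \<omega>)\<^sup>2)"
        by (intro sum.cong) auto
      then show ?case by (simp only: mem_Collect_eq)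
    qed
    have 1: "(\<lambda>\<omega>. \<Sum>k=1..j n. (m (t n k) \<omega> - m (t n (k - 1)) \<omega>)\<^sup>2) \<in> borel_measurable M"
      by (intro borel_measurable_sum borel_measurable_power borel_measurable_diff meas mem)
    have 2: "(\<lambda>\<omega>. \<Sum>k=1..j n. (\<mu> (I n k) \<omega>)\<^sup>2) \<in> borel_measurable M"
      by (intro borel_measurable_sum borel_measurable_power mu_meas sets_I)
    show "{\<omega> \<in> space M. (\<Sum>k=1..j n. (m (t n k) \<omega> - m (t n (k - 1)) \<omega>)\<^sup>2) > C} \<in> sets M"
      using 1 by measurable
    show "{\<omega> \<in> space M. (\<Sum>k=1..j n. (\<mu> (I n k) \<omega>)\<^sup>2) > C} \<in> sets M"
      using 2 by measurable
  qed
  with C show ?thesis by (intro exI[of _ C] exI[of _ n0]) simp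
qed

text \<open>The order of choices matters: a bound C for Q is taken from the tolerated probability,
  and only then \<delta>, so that \<delta> (1 + Q) is at most the tolerated distance whenever Q is
  at most C.\<close>

lemma (in prob_space) conv_in_probI_quadratic:
  fixes X Q :: "nat \<Rightarrow> 'a \<Rightarrow> real"
  assumes X: "\<And>n. X n \<in> borel_measurable M" and Y: "Y \<in> borel_measurable M" and Q: "\<And>n. Q n \<in> borel_measurable M"
    and nonneg: "\<And>n \<omega>. 0 \<le> Q n \<omega>"
    and bounded: "\<And>\<epsilon>. \<epsilon> > 0 \<Longrightarrow> \<exists>C n0. \<forall>n\<ge>n0. prob {\<omega> \<in> space M. Q n \<omega> > C} \<le> \<epsilon>"
    and le: "AE \<omega> in M. \<forall>\<delta>>0. \<forall>\<^sub>F n in sequentially. \<bar>X n \<omega> - Y \<omega>\<bar> \<le> \<delta> * (1 + Q n \<omega>)"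
  shows "conv_in_prob M X Y"
  unfolding conv_in_prob_def
proof (intro conjI allI impI X Y)
  fix \<epsilon> :: real assume \<epsilon>: "\<epsilon> > 0"
  show "(\<lambda>n. prob {\<omega> \<in> space M. \<bar>X n \<omega> - Y \<omega>\<bar> > \<epsilon>}) \<longlonglongrightarrow> 0"
  proof (rule order_tendstoI)
    fix r :: real assume "0 < r"
    then have r2: "r / 2 > 0" by simp
    obtain C n0 where C: "\<forall>n\<ge>n0. prob {\<omega> \<in> space M. Q n \<omega> > C} \<le> r / 2"
      using bounded[OF r2] by blast
    define \<delta> where "\<delta> = \<epsilon> / (1 + \<bar>C\<bar>)"
    have \<delta>: "\<delta> > 0" using \<epsilon> by (simp add: \<delta>_def)
    have bad: "(\<lambda>n. prob {\<omega> \<in> space M. \<not> \<bar>X n \<omega> - Y \<omega>\<bar> \<le> \<delta> * (1 + Q n \<omega>)}) \<longlonglongrightarrow> 0"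
    proof (rule prob_tendsto_0_AE)
      show "Measurable.pred M (\<lambda>\<omega>. \<not> \<bar>X n \<omega> - Y \<omega>\<bar> \<le> \<delta> * (1 + Q n \<omega>))" for n
        using X Y Q by measurable
      show "AE \<omega> in M. \<forall>\<^sub>F n in sequentially. \<not> \<not> \<bar>X n \<omega> - Y \<omega>\<bar> \<le> \<delta> * (1 + Q n \<omega>)"
        using le by eventually_elim (simp add: \<delta>)
    qed
    have "\<forall>\<^sub>F n in sequentially. prob {\<omega> \<in> space M. \<not> \<bar>X n \<omega> - Y \<omega>\<bar> \<le> \<delta> * (1 + Q n \<omega>)} < r / 2 \<and> n \<ge> n0"
      by (intro eventually_conj order_tendstoD(2)[OF bad r2] eventually_ge_at_top)
    then show "\<forall>\<^sub>F n in sequentially. prob {\<omega> \<in> space M. \<bar>X n \<omega> - Y \<omega>\<bar> > \<epsilon>} < r"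
    proof eventually_elim
      case (elim n)
      have "prob {\<omega> \<in> space M. \<bar>X n \<omega> - Y \<omega>\<bar> > \<epsilon>} \<le> prob {\<omega> \<in> space M. Q n \<omega> > C}
        + prob {\<omega> \<in> space M. \<not> \<bar>X n \<omega> - Y \<omega>\<bar> \<le> \<delta> * (1 + Q n \<omega>)}"
      proof (rule prob_le_add)
        show "AE \<omega> in M. \<bar>X n \<omega> - Y \<omega>\<bar> > \<epsilon> \<longrightarrow> Q n \<omega> > C \<or> \<not> \<bar>X n \<omega> - Y \<omega>\<bar> \<le> \<delta> * (1 + Q n \<omega>)"
        proof (intro AE_I2 impI)
          fix \<omega> assume *: "\<bar>X n \<omega> - Y \<omega>\<bar> > \<epsilon>"
          have "\<delta> * (1 + Q n \<omega>) \<le> \<epsilon>" if "Q n \<omega> \<le> C"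
          proof -
            have "\<delta> * (1 + Q n \<omega>) \<le> \<delta> * (1 + \<bar>C\<bar>)" using that \<delta> by (intro mult_left_mono) auto
            also have "\<dots> = \<epsilon>" by (simp add: \<delta>_def)
            finally show ?thesis .
          qed
          then show "Q n \<omega> > C \<or> \<not> \<bar>X n \<omega> - Y \<omega>\<bar> \<le> \<delta> * (1 + Q n \<omega>)" using * by linarith
        qed
        show "Measurable.pred M (\<lambda>\<omega>. Q n \<omega> > C)" using Q by measurable
        show "Measurable.pred M (\<lambda>\<omega>. \<not> \<bar>X n \<omega> - Y \<omega>\<bar> \<le> \<delta> * (1 + Q n \<omega>))" using X Y Q by measurable
      qed
      then show ?case using C elim by fastforce
    qed
  qed (auto intro!: always_eventually intro: less_le_trans)
qed

section \<open>The symmetric integral\<close>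

text \<open>\<open>m\<close> is a version of the process with almost surely continuous paths, since
  values of \<mu> are only classes of random variables. The formula is stated for every
  \<open>I\<close>, which is determined up to a null set, and integrability is asserted beside it
  because \<open>stieltjes_integral\<close> is a total function.\<close>

theorem theorem4p1:
  fixes M :: "'a measure"
    and T :: real
    and \<mu> :: "real set \<Rightarrow> 'a \<Rightarrow> real"
    and m V :: "real \<Rightarrow> 'a \<Rightarrow> real"
    and f F :: "real \<Rightarrow> real \<Rightarrow> real"
  assumes "prob_space M" and "complete_measure M"
    and "T > 0"
    and "stochastic_measure M (restrict_space borel {0..T}) \<mu>"
    and "\<And>t. t \<in> {0..T} \<Longrightarrow> m t \<in> borel_measurable M"
    and "\<And>t. t \<in> {0..T} \<Longrightarrow> AE \<omega> in M. m t \<omega> = \<mu> {0<..t} \<omega>"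
    and "AE \<omega> in M. continuous_on {0..T} (\<lambda>t. m t \<omega>)"
    and "\<And>t. t \<in> {0..T} \<Longrightarrow> V t \<in> borel_measurable M"
    and "AE \<omega> in M. continuous_on {0..T} (\<lambda>t. V t \<omega>)"
    and "AE \<omega> in M. bounded_variation 0 T (\<lambda>t. V t \<omega>)"
    and "C_partial 1 1 f"
    and "\<And>x v. F x v = (LBINT y=0..x. f y v)"
  shows "(\<exists>I. has_symmetric_integral M T (\<lambda>t \<omega>. f (m t \<omega>) (V t \<omega>)) m I) \<and>
    (\<forall>I. has_symmetric_integral M T (\<lambda>t \<omega>. f (m t \<omega>) (V t \<omega>)) m I \<longrightarrow>
      (AE \<omega> in M.
         stieltjes_integrable (\<lambda>t. deriv (\<lambda>w. F (m t \<omega>) w) (V t \<omega>)) (\<lambda>t. V t \<omega>) 0 T \<and>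
         I \<omega> = F (m T \<omega>) (V T \<omega>) - F (m 0 \<omega>) (V 0 \<omega>)
           - stieltjes_integral (\<lambda>t. deriv (\<lambda>w. F (m t \<omega>) w) (V t \<omega>)) (\<lambda>t. V t \<omega>) 0 T))"
proof -
  interpret prob_space M by fact
  note T = \<open>T > 0\<close> and m_meas = assms(5) and V_meas = assms(8)
  obtain f1 f2 where f1: "\<And>x v. ((\<lambda>y. f y v) has_real_derivative f1 x v) (at x)"
    and f2: "\<And>x v. ((\<lambda>w. f x w) has_real_derivative f2 x v) (at v)"
    and cf: "continuous_on UNIV (\<lambda>(x, v). f x v)"
    and cf1: "continuous_on UNIV (\<lambda>(x, v). f1 x v)"
    and cf2: "continuous_on UNIV (\<lambda>(x, v). f2 x v)"
    by (rule C_partial_1_1E[OF assms(11)]) (rule that)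
  define G where "G x v = (LBINT y=0..x. f2 y v)" for x v :: real
  have G: "((\<lambda>w. F x w) has_real_derivative G x v) (at v)" for x v
    unfolding assms(12) G_def by (rule primitive_has_derivative_snd[OF cf cf2 f2])
  have cF: "continuous_on UNIV (\<lambda>(x, v). F x v)" and cG: "continuous_on UNIV (\<lambda>(x, v). G x v)"
    unfolding assms(12) G_def by (rule continuous_on_primitive[OF cf], rule continuous_on_primitive[OF cf2])
  have F1: "((\<lambda>y. F y v) has_real_derivative f x v) (at x)" for x v
    unfolding assms(12)
    by (intro LBINT_has_real_derivative continuous_on_compose_curried[OF cf] continuous_intros)
  have deriv_F: "deriv (\<lambda>w. F x w) v = G x v" for x v by (rule DERIV_imp_deriv[OF G])
  have meas_comp: "(\<lambda>\<omega>. h (m s \<omega>) (V s \<omega>)) \<in> borel_measurable M"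
    if "continuous_on UNIV (\<lambda>(x, v). h x v)" "s \<in> {0..T}" for h :: "real \<Rightarrow> real \<Rightarrow> real" and s
    by (rule borel_measurable_continuous_Pair[OF m_meas V_meas])
      (use that in \<open>simp_all add: case_prod_unfold\<close>)
  define J where "J \<omega> = stieltjes_integral (\<lambda>t. G (m t \<omega>) (V t \<omega>)) (\<lambda>t. V t \<omega>) 0 T" for \<omega>
  define good where "good \<omega> \<longleftrightarrow> continuous_on {0..T} (\<lambda>t. m t \<omega>) \<and> continuous_on {0..T} (\<lambda>t. V t \<omega>)
      \<and> bounded_variation 0 T (\<lambda>t. V t \<omega>)" for \<omega>
  have good: "AE \<omega> in M. good \<omega>"
    using assms(7,9,10) by eventually_elim (simp add: good_def)
  have goodD: "continuous_on {0..T} (\<lambda>t. m t \<omega>)" "continuous_on {0..T} (\<lambda>t. V t \<omega>)"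
    "bounded_variation 0 T (\<lambda>t. V t \<omega>)" if "good \<omega>" for \<omega>
    using that by (simp_all add: good_def)
  have integrable: "stieltjes_integrable (\<lambda>t. G (m t \<omega>) (V t \<omega>)) (\<lambda>t. V t \<omega>) 0 T" if "good \<omega>" for \<omega>
    by (intro stieltjes_integrable_continuous T continuous_on_compose_curried[OF cG] goodD that)
  have J: "has_stieltjes_integral (\<lambda>t. G (m t \<omega>) (V t \<omega>)) (\<lambda>t. V t \<omega>) 0 T (J \<omega>)" if \<omega>: "good \<omega>" for \<omega>
  proof -
    obtain j where j: "has_stieltjes_integral (\<lambda>t. G (m t \<omega>) (V t \<omega>)) (\<lambda>t. V t \<omega>) 0 T j"
      using integrable[OF \<omega>] unfolding stieltjes_integrable_def by (rule exE)
    show ?thesis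
      unfolding J_def stieltjes_integral_def
      by (rule theI[where P = "has_stieltjes_integral (\<lambda>t. G (m t \<omega>) (V t \<omega>)) (\<lambda>t. V t \<omega>) 0 T", OF j]) (rule has_stieltjes_integral_unique[OF T goodD(3)[OF \<omega>] _ j])
  qed
  \<comment> \<open>One concrete admissible sequence, used for a measurable form of the right-hand
    side and again for comparing two symmetric integrals.\<close>
  define u where "u i = uniform_partition 0 T (Suc i)" for i
  have u_part: "partition_points 0 T (Suc i) (u i)" for i
    unfolding u_def by (rule partition_points_uniform) (use T in simp_all)
  have u_mesh: "(\<lambda>i. mesh (Suc i) (u i)) \<longlonglongrightarrow> 0"
    unfolding u_def by (rule mesh_uniform_tendsto)
  have u_mem: "u i k \<in> {0..T}" "u i (k - 1) \<in> {0..T}" if "k \<in> {1..Suc i}" for i k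
    using that partition_points_mem[OF u_part[of i], of k] partition_points_mem[OF u_part[of i], of "k - 1"] by auto
  \<comment> \<open>\<open>J\<close> is given by a definite description, from which measurability is
    not visible. A limit of measurable sums is measurable on the whole space, whatever its value on
    bad paths, and on good paths it equals \<open>J\<close>.\<close>
  define I0 where "I0 \<omega> = F (m T \<omega>) (V T \<omega>) - F (m 0 \<omega>) (V 0 \<omega>)
     - lim (\<lambda>i. \<Sum>k=1..Suc i. G (m (u i k) \<omega>) (V (u i k) \<omega>) * (V (u i k) \<omega> - V (u i (k - 1)) \<omega>))" for \<omega>
  have I0_eq: "I0 \<omega> = F (m T \<omega>) (V T \<omega>) - F (m 0 \<omega>) (V 0 \<omega>) - J \<omega>" if \<omega>: "good \<omega>" for \<omega>
  proof -
    have "(\<lambda>i. \<Sum>k=1..Suc i. G (m (u i k) \<omega>) (V (u i k) \<omega>) * (V (u i k) \<omega> - V (u i (k - 1)) \<omega>)) \<longlonglongrightarrow> J \<omega>"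
    proof (rule tendstoI)
      fix e :: real assume "e > 0"
      then obtain d where d: "d > 0" "\<And>n t s. partition_points 0 T n t \<Longrightarrow> mesh n t < d \<Longrightarrow> \<forall>k\<in>{1..n}. s k \<in> {t (k - 1)..t k} \<Longrightarrow>
        \<bar>(\<Sum>k=1..n. G (m (s k) \<omega>) (V (s k) \<omega>) * (V (t k) \<omega> - V (t (k - 1)) \<omega>)) - J \<omega>\<bar> < e"
        using J[OF \<omega>] unfolding has_stieltjes_integral_def by meson
      have tags: "\<forall>k\<in>{1..Suc i}. u i k \<in> {u i (k - 1)..u i k}" for i
        using partition_points_less[OF u_part[of i]] by (simp add: less_imp_le)
      have "\<forall>\<^sub>F i in sequentially. mesh (Suc i) (u i) < d" by (rule order_tendstoD(2)[OF u_mesh d(1)])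
      then show "\<forall>\<^sub>F i in sequentially. dist (\<Sum>k=1..Suc i. G (m (u i k) \<omega>) (V (u i k) \<omega>) * (V (u i k) \<omega> - V (u i (k - 1)) \<omega>)) (J \<omega>) < e"
      proof eventually_elim
        case (elim i)
        show ?case unfolding dist_real_def by (rule d(2)[OF u_part elim tags])
      qed
    qed
    then show ?thesis unfolding I0_def by (simp only: limI)
  qed
  have I0_meas: "I0 \<in> borel_measurable M"
    unfolding I0_def[abs_def] using T
    by (intro borel_measurable_diff borel_measurable_lim_metric borel_measurable_sum borel_measurable_times
        meas_comp[OF cF] meas_comp[OF cG] V_meas u_mem) auto
  have I0: "has_symmetric_integral M T (\<lambda>t \<omega>. f (m t \<omega>) (V t \<omega>)) m I0"
    unfolding has_symmetric_integral_def
  proof (intro allI impI)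
    fix j :: "nat \<Rightarrow> nat" and t :: "nat \<Rightarrow> nat \<Rightarrow> real"
    assume "\<forall>n. partition_points 0 T (j n) (t n)" and mesh: "(\<lambda>n. mesh (j n) (t n)) \<longlonglongrightarrow> 0"
    then have part: "\<And>n. partition_points 0 T (j n) (t n)" by simp
    have mem: "t n k \<in> {0..T}" "t n (k - 1) \<in> {0..T}" if "k \<in> {1..j n}" for n k
      using that partition_points_mem[OF part[of n], of k] partition_points_mem[OF part[of n], of "k - 1"] by auto
    show "conv_in_prob M (\<lambda>n. symmetric_sum (\<lambda>t \<omega>. f (m t \<omega>) (V t \<omega>)) m (j n) (t n)) I0"
    proof (rule conv_in_probI_quadratic[where Q = "\<lambda>n \<omega>. \<Sum>k=1..j n. (m (t n k) \<omega> - m (t n (k - 1)) \<omega>)\<^sup>2"])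
      show "symmetric_sum (\<lambda>t \<omega>. f (m t \<omega>) (V t \<omega>)) m (j n) (t n) \<in> borel_measurable M" for n
        unfolding symmetric_sum_def[abs_def]
        by (intro borel_measurable_sum borel_measurable_times borel_measurable_divide borel_measurable_add
            borel_measurable_diff borel_measurable_const m_meas meas_comp[OF cf] mem)
      show "I0 \<in> borel_measurable M" by (rule I0_meas)
      show "(\<lambda>\<omega>. \<Sum>k=1..j n. (m (t n k) \<omega> - m (t n (k - 1)) \<omega>)\<^sup>2) \<in> borel_measurable M" for n
        by (intro borel_measurable_sum borel_measurable_power borel_measurable_diff m_meas mem)
      show "0 \<le> (\<Sum>k=1..j n. (m (t n k) \<omega> - m (t n (k - 1)) \<omega>)\<^sup>2)" for n \<omega>
        by (rule sum_nonneg) simp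
      show "\<exists>C n0. \<forall>n\<ge>n0. prob {\<omega> \<in> space M. (\<Sum>k=1..j n. (m (t n k) \<omega> - m (t n (k - 1)) \<omega>)\<^sup>2) > C} \<le> \<epsilon>"
        if "\<epsilon> > 0" for \<epsilon>
        by (rule increments_bounded_in_prob[OF assms(4,6,5,7) part mesh that])
      show "AE \<omega> in M. \<forall>\<delta>>0. \<forall>\<^sub>F n in sequentially.
          \<bar>symmetric_sum (\<lambda>t \<omega>. f (m t \<omega>) (V t \<omega>)) m (j n) (t n) \<omega> - I0 \<omega>\<bar>
          \<le> \<delta> * (1 + (\<Sum>k=1..j n. (m (t n k) \<omega> - m (t n (k - 1)) \<omega>)\<^sup>2))"
        using good
      proof eventually_elim
        case (elim \<omega>)
        show ?case
        proof (intro allI impI)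
          fix \<delta> :: real assume \<delta>: "\<delta> > 0"
          obtain \<rho> where \<rho>: "\<rho> > 0" and est: "\<forall>n t. partition_points 0 T n t \<longrightarrow> mesh n t < \<rho> \<longrightarrow>
            \<bar>(\<Sum>k=1..n. (f (m (t (k - 1)) \<omega>) (V (t (k - 1)) \<omega>) + f (m (t k) \<omega>) (V (t k) \<omega>)) / 2
                * (m (t k) \<omega> - m (t (k - 1)) \<omega>))
              - (F (m T \<omega>) (V T \<omega>) - F (m 0 \<omega>) (V 0 \<omega>) - J \<omega>)\<bar>
            \<le> \<delta> * (1 + (\<Sum>k=1..n. (m (t k) \<omega> - m (t (k - 1)) \<omega>)\<^sup>2))"
            using symmetric_sum_estimate[OF f1 f2 F1 G cf1 cf2 cG goodD[OF elim] J[OF elim] T \<delta>]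
            by (elim exE conjE)
          have "\<forall>\<^sub>F n in sequentially. mesh (j n) (t n) < \<rho>" by (rule order_tendstoD(2)[OF mesh \<rho>])
          then show "\<forall>\<^sub>F n in sequentially.
            \<bar>symmetric_sum (\<lambda>t \<omega>. f (m t \<omega>) (V t \<omega>)) m (j n) (t n) \<omega> - I0 \<omega>\<bar>
            \<le> \<delta> * (1 + (\<Sum>k=1..j n. (m (t n k) \<omega> - m (t n (k - 1)) \<omega>)\<^sup>2))"
          proof eventually_elim
            case (elim n)
            show ?case unfolding symmetric_sum_def I0_eq[OF \<open>good \<omega>\<close>]
              by (rule est[rule_format, OF part elim])
          qed
        qed
      qed
    qed
  qed
  show ?thesis
  proof (intro conjI allI impI)
    show "\<exists>I. has_symmetric_integral M T (\<lambda>t \<omega>. f (m t \<omega>) (V t \<omega>)) m I" by (rule exI[where x = I0]) (rule I0)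
    fix I assume I: "has_symmetric_integral M T (\<lambda>t \<omega>. f (m t \<omega>) (V t \<omega>)) m I"
    have conv: "conv_in_prob M (\<lambda>i. symmetric_sum (\<lambda>t \<omega>. f (m t \<omega>) (V t \<omega>)) m (Suc i) (u i)) I'"
      if "has_symmetric_integral M T (\<lambda>t \<omega>. f (m t \<omega>) (V t \<omega>)) m I'" for I'
      using that[unfolded has_symmetric_integral_def, rule_format, of Suc u, OF u_part u_mesh] .
    \<comment> \<open>Both are limits in probability of the same symmetric sums along
      \<open>u\<close>.\<close>
    have "AE \<omega> in M. I \<omega> = I0 \<omega>" by (rule conv_in_prob_unique[OF conv[OF I] conv[OF I0]])
    with good show "AE \<omega> in M.
         stieltjes_integrable (\<lambda>t. deriv (\<lambda>w. F (m t \<omega>) w) (V t \<omega>)) (\<lambda>t. V t \<omega>) 0 T \<and>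
         I \<omega> = F (m T \<omega>) (V T \<omega>) - F (m 0 \<omega>) (V 0 \<omega>)
           - stieltjes_integral (\<lambda>t. deriv (\<lambda>w. F (m t \<omega>) w) (V t \<omega>)) (\<lambda>t. V t \<omega>) 0 T"
      unfolding deriv_F J_def[symmetric]
      by eventually_elim (simp add: integrable I0_eq)
  qed
qed

end
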